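(* Let $\boldsymbol\tau = (\tau_n \colon \mathcal A_{n+1}^* \to \mathcal A_n^* : n \geq 0)$ be an everywhere growing directive sequence. Define $B_{n,m}(a) = \{\tau_{n,m}(x) : x \in X_{\boldsymbol\tau}^{(m)},\ x_0 = a\}$ for $m > n \geq 0$ and $a \in \mathcal A_m$. Then the following conditions are equivalent: \begin{enumerate} \item[(1)] there exists a contraction of $\boldsymbol\tau$ that is decisive; \item[(2)] for any $\boldsymbol\tau$-address $(u_j,a_j)_{j\geq0}$ and any $n \geq 0$, the nested sequence of sets $$\Big( S^{\sum_{n \leq j < m} |\tau_{n,j}(u_j)|} B_{n,m}(a_m) : m > n\Big)$$ contains a single element in its intersection; \item[(3)] for each $n \ge 0$, the sequence of covers $\big(\{ S^k B_{n,m}(a) : a \in \mathcal A_m,\ 0 \leq k < |\tau_{n,m}(a)|\}\big)_{m>n}$ of $X^{(n)}_{\boldsymbol\tau}$ generates the topology of $X_{\boldsymbol\tau}^{(n)}$. \end{enumerate}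
   Context: Alphabets are finite sets with at least two elements. $\mathcal A^*$ is the free monoid of finite words and $|w|$ the length of $w$. $S$ is the shift map $S((x_k)_k)=(x_{k+1})_k$; $\mathcal L(X)$ is the set of finite words occurring in points of a subshift $X$. A substitution $\tau:\mathcal A^*\to\mathcal B^*$ is a monoid morphism such that $\tau(a)$ is non-empty for every $a\in\mathcal A$ and every $b\in\mathcal B$ occurs in some $\tau(a)$; it acts on $x\in\mathcal A^{\mathbb Z}$ by concatenation, with $\tau(x_0)$ starting at coordinate $0$. A directive sequence $\boldsymbol\tau=(\tau_n)_{n\ge0}$ consists of substitutions $\tau_n:\mathcal A_{n+1}^*\to\mathcal A_n^*$. Put $\tau_{n,m}=\tau_n\circ\cdots\circ\tau_{m-1}$ for $m>n$ and $\tau_{n,n}=\mathrm{id}$. $X^{(n)}_{\boldsymbol\tau}$ is the set of $x\in\mathcal A_n^{\mathbb Z}$ such that every finite factor of $x$ occurs in $\tau_{n,m}(a)$ for some $m>n$ and $a\in\mathcal A_m$. $\boldsymbol\tau$ is everywhere growing if $\min_{a\in\mathcal A_n}|\tau_{0,n}(a)|\to\infty$ as $n\to\infty$. The contraction of $\boldsymbol\tau$ along integers $n_0<n_1<\cdots$ is the directive sequence $(\tau_{0,n_0},\tau_{n_0,n_1},\tau_{n_1,n_2},\dots)$, where $\tau_{0,n_0}$ is the identity (and may be omitted) if $n_0=0$. An everywhere growing directive sequence is decisive if for every $n\ge0$ there exist maps $\ell,r:\mathcal A_{n+1}\to\mathcal A_n$ such that, for all letters $a,b$ with $ab\in\mathcal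 L(X^{(n+1)}_{\boldsymbol\tau})$, the word $\tau_n(b)$ begins with $r(a)$ and $\tau_n(a)$ ends with $\ell(b)$. A $\boldsymbol\tau$-address is a sequence $(u_j,a_j)_{j\ge0}$ with $u_j\in\mathcal A_j^*$ and $a_j\in\mathcal A_j\cap\mathcal L(X^{(j)}_{\boldsymbol\tau})$ such that $u_ja_j$ is a prefix of $\tau_j(a_{j+1})$ for all $j\ge0$. A sequence $(\mathcal P_m)_{m>n}$ of covers of $X^{(n)}_{\boldsymbol\tau}$ generates the topology if for every $x\in X^{(n)}_{\boldsymbol\tau}$ and every neighbourhood $U$ of $x$ there is $m>n$ such that every element of $\mathcal P_m$ containing $x$ is contained in $U$. *)

theory Defs
  imports "HOL-Analysis.Analysis" "HOL-Library.Sublist"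
begin

definition alphabet :: "'a set \<Rightarrow> bool" where
  "alphabet A \<longleftrightarrow> finite A \<and> 2 \<le> card A"

definition shift :: "(int \<Rightarrow> 'a) \<Rightarrow> (int \<Rightarrow> 'a)" where
  "shift x = (\<lambda>i. x (i + 1))"

definition factors :: "(int \<Rightarrow> 'a) \<Rightarrow> 'a list set" where
  "factors x = {map x [i..j] | i j. True}"

definition language :: "(int \<Rightarrow> 'a) set \<Rightarrow> 'a list set" where
  "language X = (\<Union>x\<in>X. factors x)"

text \<open>A morphism of free monoids is given by its values on letters; values outside the
  domain alphabet are irrelevant. The morphism itself is \<^term>\<open>subst_word \<sigma>\<close>.\<close>

definition substitution :: "'a set \<Rightarrow> 'b set \<Rightarrow> ('a \<Rightarrow> 'b list) \<Rightarrow> bool" where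
  "substitution A B \<sigma> \<longleftrightarrow>
     (\<forall>a\<in>A. \<sigma> a \<in> lists B \<and> \<sigma> a \<noteq> []) \<and> (\<forall>b\<in>B. \<exists>a\<in>A. b \<in> set (\<sigma> a))"

definition subst_word :: "('a \<Rightarrow> 'b list) \<Rightarrow> 'a list \<Rightarrow> 'b list" where
  "subst_word \<sigma> w = concat (map \<sigma> w)"

text \<open>The action on bi-infinite sequences: the image of \<open>x 0\<close> starts at coordinate \<open>0\<close>.
  Since images of letters are non-empty, coordinate \<open>i \<ge> 0\<close> lies in the image of
  \<open>x 0, \<dots>, x i\<close>, and coordinate \<open>i < 0\<close> lies in the image of \<open>x i, \<dots>, x (-1)\<close>, which ends at
  coordinate \<open>-1\<close>. Lemmas \<open>subst_seq_nonneg\<close> and \<open>subst_seq_neg\<close> confirm that this is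
  bi-infinite concatenation.\<close>

definition subst_seq :: "('a \<Rightarrow> 'b list) \<Rightarrow> (int \<Rightarrow> 'a) \<Rightarrow> (int \<Rightarrow> 'b)" where
  "subst_seq \<sigma> x i =
     (if 0 \<le> i then subst_word \<sigma> (map x [0..i]) ! nat i
      else rev (subst_word \<sigma> (map x [i..-1])) ! nat (- i - 1))"

lemma length_subst_word_ge:
  assumes "\<And>a. a \<in> set w \<Longrightarrow> \<sigma> a \<noteq> []"
  shows "length w \<le> length (subst_word \<sigma> w)"
  using assms
proof (induction w)
  case (Cons a w)
  then have "Suc 0 \<le> length (\<sigma> a)" "length w \<le> length (subst_word \<sigma> w)"
    by (auto simp: Suc_le_eq)
  then show ?case by (simp add: subst_word_def)
qed (simp add: subst_word_def)

lemma nth_prefix_comparable: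
  assumes "prefix u v \<or> prefix v u" "i < length u" "i < length v"
  shows "u ! i = v ! i"
  using assms by (auto simp: prefix_def nth_append)

lemma subst_seq_nonneg:
  assumes "\<And>i. \<sigma> (x i) \<noteq> []" and "i < length (subst_word \<sigma> (map x [0..k]))"
  shows "subst_seq \<sigma> x (int i) = subst_word \<sigma> (map x [0..k]) ! i"
proof -
  have pre: "prefix (subst_word \<sigma> (map x [0..l])) (subst_word \<sigma> (map x [0..m]))" if "l \<le> m" for l m
  proof (cases "0 \<le> l")
    case True
    then have "[0..m] = [0..l] @ [l+1..m]" using that by (intro upto_split2) auto
    then show ?thesis by (simp add: subst_word_def)
  qed (simp add: subst_word_def)
  have "length (map x [0..int i]) \<le> length (subst_word \<sigma> (map x [0..int i]))"
    using assms(1) by (intro length_subst_word_ge) auto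
  then have "i < length (subst_word \<sigma> (map x [0..int i]))" by simp
  moreover have "prefix (subst_word \<sigma> (map x [0..int i])) (subst_word \<sigma> (map x [0..k])) \<or>
      prefix (subst_word \<sigma> (map x [0..k])) (subst_word \<sigma> (map x [0..int i]))"
    using pre by (meson linear)
  ultimately show ?thesis
    unfolding subst_seq_def using assms(2) by (simp add: nth_prefix_comparable)
qed

lemma subst_seq_neg:
  assumes "\<And>i. \<sigma> (x i) \<noteq> []" and "i < length (subst_word \<sigma> (map x [k..-1]))"
  shows "subst_seq \<sigma> x (int i - int (length (subst_word \<sigma> (map x [k..-1]))))
           = subst_word \<sigma> (map x [k..-1]) ! i"
proof -
  define W where "W = (\<lambda>k. rev (subst_word \<sigma> (map x [k..-1])))"
  have pre: "prefix (W m) (W l)" if "l \<le> m" for l m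
  proof (cases "m \<le> -1")
    case True
    then have "[l..-1] = [l..m-1] @ [m..-1]" using that by (intro upto_split1) auto
    then show ?thesis by (simp add: subst_word_def W_def)
  qed (simp add: subst_word_def W_def)
  define j where "j = length (W k) - 1 - i"
  have j: "j < length (W k)" and eq: "int i - int (length (W k)) = - int j - 1"
    using assms(2) by (auto simp: j_def W_def)
  have "length (map x [- int j - 1..-1]) \<le> length (subst_word \<sigma> (map x [- int j - 1..-1]))"
    using assms(1) by (intro length_subst_word_ge) auto
  then have "j < length (W (- int j - 1))" by (simp add: W_def)
  moreover have "prefix (W (- int j - 1)) (W k) \<or> prefix (W k) (W (- int j - 1))"
    using pre by (meson linear)
  ultimately have "W (- int j - 1) ! j = W k ! j" using j by (simp add: nth_prefix_comparable)
  moreover have "W k ! j = subst_word \<sigma> (map x [k..-1]) ! i"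
    using assms(2) j by (simp add: W_def rev_nth j_def)
  moreover have "length (W k) = length (subst_word \<sigma> (map x [k..-1]))" by (simp add: W_def)
  moreover have "subst_seq \<sigma> x (- int j - 1) = W (- int j - 1) ! j"
    by (simp add: subst_seq_def W_def)
  ultimately show ?thesis using eq by simp
qed

text \<open>A countable family of finite alphabets embeds in a single type, so taking all the
  \<open>A n\<close> as subsets of one type variable loses no generality.\<close>

definition directive_sequence :: "(nat \<Rightarrow> 'a set) \<Rightarrow> (nat \<Rightarrow> 'a \<Rightarrow> 'a list) \<Rightarrow> bool" where
  "directive_sequence A \<tau> \<longleftrightarrow>
     (\<forall>n. alphabet (A n)) \<and> (\<forall>n. substitution (A (Suc n)) (A n) (\<tau> n))"

text \<open>For \<open>m \<ge> n\<close> this applies \<open>\<tau> (m - 1)\<close> first and \<open>\<tau> n\<close> last.\<close>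

definition composite :: "(nat \<Rightarrow> 'a \<Rightarrow> 'a list) \<Rightarrow> nat \<Rightarrow> nat \<Rightarrow> 'a list \<Rightarrow> 'a list" where
  "composite \<tau> n m w = foldr (\<lambda>k. subst_word (\<tau> k)) [n..<m] w"

abbreviation composite_letter :: "(nat \<Rightarrow> 'a \<Rightarrow> 'a list) \<Rightarrow> nat \<Rightarrow> nat \<Rightarrow> 'a \<Rightarrow> 'a list" where
  "composite_letter \<tau> n m \<equiv> (\<lambda>a. composite \<tau> n m [a])"

definition level_shift ::
    "(nat \<Rightarrow> 'a set) \<Rightarrow> (nat \<Rightarrow> 'a \<Rightarrow> 'a list) \<Rightarrow> nat \<Rightarrow> (int \<Rightarrow> 'a) set" where
  "level_shift A \<tau> n =
     {x. range x \<subseteq> A n \<and>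
         (\<forall>w\<in>factors x. \<exists>m>n. \<exists>a\<in>A m. sublist w (composite_letter \<tau> n m a))}"

definition level_topology ::
    "(nat \<Rightarrow> 'a set) \<Rightarrow> (nat \<Rightarrow> 'a \<Rightarrow> 'a list) \<Rightarrow> nat \<Rightarrow> (int \<Rightarrow> 'a) topology" where
  "level_topology A \<tau> n =
     subtopology (product_topology (\<lambda>_. discrete_topology (A n)) UNIV) (level_shift A \<tau> n)"

definition everywhere_growing :: "(nat \<Rightarrow> 'a set) \<Rightarrow> (nat \<Rightarrow> 'a \<Rightarrow> 'a list) \<Rightarrow> bool" where
  "everywhere_growing A \<tau> \<longleftrightarrow>
     filterlim (\<lambda>n. Min ((\<lambda>a. length (composite_letter \<tau> 0 n a)) ` A n)) at_top at_top"

definition decisive :: "(nat \<Rightarrow> 'a set) \<Rightarrow> (nat \<Rightarrow> 'a \<Rightarrow> 'a list) \<Rightarrow> bool" where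
  "decisive A \<tau> \<longleftrightarrow>
     directive_sequence A \<tau> \<and> everywhere_growing A \<tau> \<and>
     (\<forall>n. \<exists>l r. l \<in> A (Suc n) \<rightarrow> A n \<and> r \<in> A (Suc n) \<rightarrow> A n \<and>
        (\<forall>a\<in>A (Suc n). \<forall>b\<in>A (Suc n). [a, b] \<in> language (level_shift A \<tau> (Suc n)) \<longrightarrow>
           prefix [r a] (\<tau> n b) \<and> suffix [l b] (\<tau> n a)))"

text \<open>If \<open>k 0 = 0\<close>, the initial identity may be kept (first alternative) or omitted (second
  alternative).\<close>

definition is_contraction ::
    "(nat \<Rightarrow> 'a set) \<Rightarrow> (nat \<Rightarrow> 'a \<Rightarrow> 'a list) \<Rightarrow> (nat \<Rightarrow> 'a set) \<Rightarrow> (nat \<Rightarrow> 'a \<Rightarrow> 'a list) \<Rightarrow> bool" where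
  "is_contraction A \<tau> A' \<tau>' \<longleftrightarrow>
     (\<exists>k. strict_mono k \<and>
        ((A' = case_nat (A 0) (\<lambda>i. A (k i)) \<and>
          \<tau>' = case_nat (composite_letter \<tau> 0 (k 0)) (\<lambda>i. composite_letter \<tau> (k i) (k (Suc i))))
         \<or> (k 0 = 0 \<and> A' = (\<lambda>i. A (k i)) \<and>
            \<tau>' = (\<lambda>i. composite_letter \<tau> (k i) (k (Suc i))))))"

definition address ::
    "(nat \<Rightarrow> 'a set) \<Rightarrow> (nat \<Rightarrow> 'a \<Rightarrow> 'a list) \<Rightarrow> (nat \<Rightarrow> 'a list) \<Rightarrow> (nat \<Rightarrow> 'a) \<Rightarrow> bool" where
  "address A \<tau> u a \<longleftrightarrow>
     (\<forall>j. u j \<in> lists (A j) \<and> a j \<in> A j \<and> [a j] \<in> language (level_shift A \<tau> j) \<and>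
          prefix (u j @ [a j]) (\<tau> j (a (Suc j))))"

definition base ::
    "(nat \<Rightarrow> 'a set) \<Rightarrow> (nat \<Rightarrow> 'a \<Rightarrow> 'a list) \<Rightarrow> nat \<Rightarrow> nat \<Rightarrow> 'a \<Rightarrow> (int \<Rightarrow> 'a) set" where
  "base A \<tau> n m a =
     {subst_seq (composite_letter \<tau> n m) x | x. x \<in> level_shift A \<tau> m \<and> x 0 = a}"

definition tower_cover ::
    "(nat \<Rightarrow> 'a set) \<Rightarrow> (nat \<Rightarrow> 'a \<Rightarrow> 'a list) \<Rightarrow> nat \<Rightarrow> nat \<Rightarrow> (int \<Rightarrow> 'a) set set" where
  "tower_cover A \<tau> n m =
     {(shift ^^ k) ` base A \<tau> n m a | a k. a \<in> A m \<and> k < length (composite_letter \<tau> n m a)}"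

text \<open>The notion applies to sequences \<open>(P\<^sub>m)\<close>, \<open>m > n\<close>, of covers, hence the first conjunct.\<close>

definition generates_topology :: "'b topology \<Rightarrow> nat \<Rightarrow> (nat \<Rightarrow> 'b set set) \<Rightarrow> bool" where
  "generates_topology T n P \<longleftrightarrow>
     (\<forall>m>n. \<Union> (P m) = topspace T) \<and>
     (\<forall>x\<in>topspace T. \<forall>U. (\<exists>W. openin T W \<and> x \<in> W \<and> W \<subseteq> U) \<longrightarrow>
        (\<exists>m>n. \<forall>V\<in>P m. x \<in> V \<longrightarrow> V \<subseteq> U))"

end

theory Submission
  imports Defs
begin

text \<open>All three conditions are equivalent to a fourth one, \<open>narrowing\<close>: for every level \<open>n\<close> and every
  \<open>N\<close> there is \<open>m > n\<close> such that each set \<open>S\<^sup>k B\<^sub>n\<^sub>m(a)\<close> with \<open>k\<close> inside the block of \<open>a\<close> (a \<^emph>\<open>level\<close>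
  of a tower) consists of points that agree on \<open>[-N, N]\<close>.

  \<^item> \<^emph>\<open>Decisive contractions.\<close> Decisiveness of \<open>\<tau>\<^sub>p\<^sub>m\<close> means that the block \<open>\<tau>\<^sub>p\<^sub>m(a)\<close>, wherever it
  comes from a letter \<open>a\<close> of a point of the level \<open>m\<close> shift, is preceded and followed by letters
  that depend on \<open>a\<close> only. Applying \<open>\<tau>\<^sub>n\<^sub>p\<close> turns these two letters into words as long as desired
  once \<open>p\<close> is large, by growth, so tower levels become narrow (\<open>narrow_if_decisive_step\<close>).
  Conversely, narrowness for the window \<open>[-1, 1]\<close> alone gives decisiveness of \<open>\<tau>\<^sub>n\<^sub>m\<close>: looking at the
  first and at the last coordinate of the block of \<open>a\<close>, the neighbouring letters are determined
  (\<open>decisive_step_if_narrow\<close>). Iterating \<open>n \<mapsto> m\<close> gives the contraction.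

  \<^item> \<^emph>\<open>Addresses.\<close> The sets attached to an address are nested non-empty closed subsets of a
  compact space, so they always have a common point (\<open>address_limit\<close>); only uniqueness is at
  stake, and narrow tower levels force it. Conversely, if narrowing fails at \<open>n\<close> and \<open>N\<close>, each
  \<open>m > n\<close> has a tower level with two points that differ on \<open>[-N, N]\<close>. Each tower level for
  \<open>m + 1\<close> is contained in one for \<open>m\<close>, with finitely many choices at each stage, so Koenig's lemma
  gives an infinite nested sequence of such levels, that is, an address. If the intersection along
  it were a single point \<open>y\<close>, points of the levels that differ from \<open>y\<close> on \<open>[-N, N]\<close> would
  accumulate at another point of the intersection
  (\<open>addresses_determine_points_imp_narrowing\<close>).

  \<^item> \<^emph>\<open>Topology.\<close> Neighbourhoods are determined by central windows, so narrowing makes the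
  covers generate the topology. Conversely, if the covers generate it, a neighbourhood of \<open>y\<close> that
  excludes \<open>y'\<close> contains one of the sets along an address of \<open>y\<close>, so \<open>y\<close> and \<open>y'\<close> cannot share an
  address (\<open>generates_topology_imp_addresses_determine_points\<close>). That the sets do cover the level
  \<open>n\<close> shift is a compactness argument of its own (\<open>point_in_tower_level\<close>).\<close>

section \<open>Words of bi-infinite sequences\<close>

definition factor_at :: "(int \<Rightarrow> 'a) \<Rightarrow> int \<Rightarrow> nat \<Rightarrow> 'a list" where
  "factor_at x p l = map (\<lambda>i. x (p + int i)) [0..<l]"

lemma length_factor_at [simp]: "length (factor_at x p l) = l"
  by (simp add: factor_at_def)

lemma nth_factor_at [simp]: "i < l \<Longrightarrow> factor_at x p l ! i = x (p + int i)"
  by (simp add: factor_at_def)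

lemma factor_at_0 [simp]: "factor_at x p 0 = []"
  by (simp add: factor_at_def)

lemma factor_at_1 [simp]: "factor_at x p (Suc 0) = [x p]"
  by (simp add: factor_at_def)

lemma factor_at_add: "factor_at x p (k + l) = factor_at x p k @ factor_at x (p + int k) l"
  by (rule nth_equalityI) (auto simp: nth_append algebra_simps)

lemma factor_at_Suc: "factor_at x p (Suc l) = factor_at x p l @ [x (p + int l)]"
  by (simp add: factor_at_def)

lemma factor_at_translate: "factor_at (\<lambda>i. x (i + c)) p l = factor_at x (p + c) l"
  by (rule nth_equalityI) (auto simp: algebra_simps)

lemma map_upto_eq_factor_at: "map x [i..j] = factor_at x i (nat (j - i + 1))"
  by (rule nth_equalityI) auto

lemma factors_eq: "factors x = {factor_at x p l | p l. True}"
proof -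
  have "\<exists>i j. factor_at x p l = map x [i..j]" for p l
    by (rule exI[of _ p], rule exI[of _ "p + int l - 1"]) (simp add: map_upto_eq_factor_at)
  moreover have "\<exists>p l. map x [i..j] = factor_at x p l" for i j
    using map_upto_eq_factor_at by blast
  ultimately show ?thesis unfolding factors_def by auto
qed

lemma factor_at_sublist:
  assumes "P \<le> p" "p + int l \<le> P + int L"
  shows "sublist (factor_at x p l) (factor_at x P L)"
proof -
  define k where "k = nat (p - P)"
  have "L = k + (l + (L - k - l))" "p = P + int k"
    using assms by (auto simp: k_def)
  then have "factor_at x P L =
      factor_at x P k @ factor_at x p l @ factor_at x (p + int l) (L - k - l)"
    by (metis factor_at_add)
  then show ?thesis by (auto simp: sublist_def)
qed

lemma shift_power: "(shift ^^ k) x = (\<lambda>i. x (i + int k))"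
  by (induction k arbitrary: x) (auto simp: shift_def algebra_simps)

section \<open>Substitutions acting on bi-infinite sequences\<close>

lemma subst_word_Nil [simp]: "subst_word \<sigma> [] = []"
  and subst_word_Cons: "subst_word \<sigma> (a # w) = \<sigma> a @ subst_word \<sigma> w"
  and subst_word_append: "subst_word \<sigma> (v @ w) = subst_word \<sigma> v @ subst_word \<sigma> w"
  and subst_word_single: "subst_word \<sigma> [a] = \<sigma> a"
  by (simp_all add: subst_word_def)

lemma subst_word_subst_word:
  "subst_word \<rho> (subst_word \<sigma> w) = subst_word (\<lambda>a. subst_word \<rho> (\<sigma> a)) w"
  by (induction w) (auto simp: subst_word_Cons subst_word_append)

lemma length_subst_word_le:
  assumes "\<And>a. a \<in> set w \<Longrightarrow> length (\<sigma> a) \<le> L"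
  shows "length (subst_word \<sigma> w) \<le> L * length w"
  using assms by (induction w) (auto simp: subst_word_Cons add_mono)

lemma subst_word_locate:
  assumes "k < length (subst_word \<sigma> w)"
  shows "\<exists>u c v k'. w = u @ c # v \<and> k = length (subst_word \<sigma> u) + k' \<and> k' < length (\<sigma> c)"
  using assms
proof (induction w arbitrary: k)
  case (Cons a w)
  show ?case
  proof (cases "k < length (\<sigma> a)")
    case True
    then show ?thesis by (intro exI[of _ "[]"] exI[of _ a] exI[of _ w] exI[of _ k]) simp
  next
    case False
    then have "k - length (\<sigma> a) < length (subst_word \<sigma> w)"
      using Cons.prems by (auto simp: subst_word_Cons)
    from Cons.IH[OF this] obtain u c v k' where
      "w = u @ c # v" "k - length (\<sigma> a) = length (subst_word \<sigma> u) + k'" "k' < length (\<sigma> c)"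
      by blast
    then show ?thesis using False
      by (intro exI[of _ "a # u"] exI[of _ c] exI[of _ v] exI[of _ k']) (auto simp: subst_word_Cons)
  qed
qed simp

text \<open>The coordinate at which the image of the letter \<open>x i\<close> starts in the image of \<open>x\<close>; it lets
  positive and negative coordinates be treated alike.\<close>

definition block_start :: "('a \<Rightarrow> 'b list) \<Rightarrow> (int \<Rightarrow> 'a) \<Rightarrow> int \<Rightarrow> int" where
  "block_start \<sigma> x i =
     (if 0 \<le> i then int (length (subst_word \<sigma> (factor_at x 0 (nat i))))
      else - int (length (subst_word \<sigma> (factor_at x i (nat (- i))))))"

lemma block_start_0 [simp]: "block_start \<sigma> x 0 = 0"
  by (simp add: block_start_def)

lemma block_start_add:
  "block_start \<sigma> x (p + int l) = block_start \<sigma> x p + int (length (subst_word \<sigma> (factor_at x p l)))"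
proof -
  consider "0 \<le> p" | "p < 0" "0 \<le> p + int l" | "p + int l < 0" by linarith
  then show ?thesis
  proof cases
    case 1
    then have "nat (p + int l) = nat p + l" by simp
    with 1 show ?thesis
      by (simp add: block_start_def factor_at_add subst_word_append)
  next
    case 2
    then have "l = nat (- p) + nat (p + int l)" by simp
    then have "factor_at x p l = factor_at x p (nat (- p)) @ factor_at x 0 (nat (p + int l))"
      using 2 by (metis add.commute add_uminus_conv_diff cancel_comm_monoid_add_class.diff_cancel
          factor_at_add int_nat_eq neg_0_less_iff_less less_imp_le)
    with 2 show ?thesis by (simp add: block_start_def subst_word_append)
  next
    case 3
    then have "nat (- p) = l + nat (- (p + int l))" by simp
    then have "factor_at x p (nat (- p)) = factor_at x p l @ factor_at x (p + int l) (nat (- (p + int l)))"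
      by (metis factor_at_add)
    with 3 show ?thesis by (simp add: block_start_def subst_word_append)
  qed
qed

lemma block_start_Suc: "block_start \<sigma> x (i + 1) = block_start \<sigma> x i + int (length (\<sigma> (x i)))"
  using block_start_add[of \<sigma> x i 1] by (simp add: subst_word_single)

lemma subst_seq_block:
  assumes ne: "\<And>i. \<sigma> (x i) \<noteq> []" and j: "j < length (\<sigma> (x i))"
  shows "subst_seq \<sigma> x (block_start \<sigma> x i + int j) = \<sigma> (x i) ! j"
proof (cases "0 \<le> i")
  case True
  have "map x [0..i] = factor_at x 0 (nat i) @ [x i]"
    using True by (simp add: map_upto_eq_factor_at nat_add_distrib factor_at_Suc)
  then have eq: "subst_word \<sigma> (map x [0..i]) = subst_word \<sigma> (factor_at x 0 (nat i)) @ \<sigma> (x i)"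
    by (simp add: subst_word_append subst_word_single)
  have "subst_seq \<sigma> x (int (length (subst_word \<sigma> (factor_at x 0 (nat i))) + j)) = \<sigma> (x i) ! j"
    by (subst subst_seq_nonneg[where k = i]) (use ne j in \<open>simp_all add: eq nth_append\<close>)
  then show ?thesis using True by (simp add: block_start_def)
next
  case False
  then have "map x [i..-1] = x i # map x [i+1..-1]" by (simp add: upto_rec1)
  then have eq: "subst_word \<sigma> (map x [i..-1]) = \<sigma> (x i) @ subst_word \<sigma> (map x [i+1..-1])"
    by (simp add: subst_word_Cons)
  have "subst_seq \<sigma> x (int j - int (length (subst_word \<sigma> (map x [i..-1])))) = \<sigma> (x i) ! j"
    by (subst subst_seq_neg) (use ne j in \<open>simp_all add: eq nth_append\<close>)
  then show ?thesis using False
    by (simp add: block_start_def map_upto_eq_factor_at)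
qed

text \<open>Substitution commutes with reading off a word. With \<open>block_start_locate\<close> this characterises
  the image sequence.\<close>

lemma factor_at_subst_seq:
  assumes ne: "\<And>i. \<sigma> (x i) \<noteq> []"
  shows "factor_at (subst_seq \<sigma> x) (block_start \<sigma> x p) (length (subst_word \<sigma> (factor_at x p l)))
           = subst_word \<sigma> (factor_at x p l)"
proof (induction l)
  case (Suc l)
  have "factor_at (subst_seq \<sigma> x) (block_start \<sigma> x (p + int l)) (length (\<sigma> (x (p + int l))))
      = \<sigma> (x (p + int l))"
    by (rule nth_equalityI) (auto simp: subst_seq_block[of \<sigma> x, OF ne])
  then show ?case using Suc
    by (simp add: factor_at_Suc subst_word_append subst_word_single factor_at_add block_start_add)
qed simp

text \<open>The blocks tile the whole line, since they are non-empty.\<close>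

lemma block_start_locate:
  assumes ne: "\<And>i. \<sigma> (x i) \<noteq> []"
  shows "\<exists>i j. t = block_start \<sigma> x i + int j \<and> j < length (\<sigma> (x i))"
proof (induction t rule: int_induct[where k = 0])
  case base
  show ?case using ne by (intro exI[of _ 0]) simp
next
  case (step1 t)
  then obtain i j where ij: "t = block_start \<sigma> x i + int j" "j < length (\<sigma> (x i))" by blast
  show ?case
  proof (cases "Suc j < length (\<sigma> (x i))")
    case True
    with ij show ?thesis by (intro exI[of _ i] exI[of _ "Suc j"]) simp
  next
    case False
    with ij have "t + 1 = block_start \<sigma> x (i + 1)" by (simp add: block_start_Suc)
    with ne show ?thesis by (intro exI[of _ "i + 1"] exI[of _ 0]) simp
  qed
next
  case (step2 t)
  then obtain i j where ij: "t = block_start \<sigma> x i + int j" "j < length (\<sigma> (x i))" by blast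
  show ?case
  proof (cases j)
    case 0
    have "0 < length (\<sigma> (x (i - 1)))" using ne by simp
    with ij 0 show ?thesis using block_start_Suc[of \<sigma> x "i - 1"]
      by (intro exI[of _ "i - 1"] exI[of _ "length (\<sigma> (x (i - 1))) - 1"])
        (simp add: of_nat_diff Suc_le_eq)
  next
    case (Suc j')
    with ij show ?thesis by (intro exI[of _ i] exI[of _ j']) simp
  qed
qed

lemma block_start_diff_ge:
  assumes ne: "\<And>i. \<sigma> (x i) \<noteq> []" and "i \<le> j"
  shows "j - i \<le> block_start \<sigma> x j - block_start \<sigma> x i"
proof -
  have "length (factor_at x i (nat (j - i))) \<le> length (subst_word \<sigma> (factor_at x i (nat (j - i))))"
    by (rule length_subst_word_ge) (use ne in \<open>auto simp: factor_at_def\<close>)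
  then show ?thesis using block_start_add[of \<sigma> x i "nat (j - i)"] assms(2) by simp
qed

lemma block_start_translate:
  "block_start \<sigma> (\<lambda>i. x (i + c)) i = block_start \<sigma> x (i + c) - block_start \<sigma> x c"
proof (cases "0 \<le> i")
  case True
  then show ?thesis using block_start_add[of \<sigma> x c "nat i"]
    by (simp add: block_start_def[of _ "\<lambda>i. x (i + c)"] factor_at_translate add.commute)
next
  case False
  then show ?thesis using block_start_add[of \<sigma> x "i + c" "nat (- i)"]
    by (simp add: block_start_def[of _ "\<lambda>i. x (i + c)"] factor_at_translate add.commute)
qed

lemma subst_seq_translate:
  assumes ne: "\<And>i. \<sigma> (x i) \<noteq> []"
  shows "subst_seq \<sigma> (\<lambda>i. x (i + c)) t = subst_seq \<sigma> x (t + block_start \<sigma> x c)"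
proof -
  obtain i j where "t = block_start \<sigma> (\<lambda>i. x (i + c)) i + int j" "j < length (\<sigma> (x (i + c)))"
    using block_start_locate[of \<sigma> "\<lambda>i. x (i + c)"] ne by blast
  then show ?thesis
    using subst_seq_block[of \<sigma> "\<lambda>i. x (i + c)" j i] subst_seq_block[of \<sigma> x j "i + c"] ne
    by (simp add: block_start_translate)
qed

text \<open>A window around the origin fixes both the contents of its blocks and, because it contains the
  origin, their location.\<close>

lemma subst_seq_cong:
  assumes ne: "\<And>i. \<sigma> (x i) \<noteq> []" "\<And>i. \<sigma> (x' i) \<noteq> []"
    and pq: "p \<le> 0" "0 \<le> q" and eq: "\<And>i. p \<le> i \<Longrightarrow> i < q \<Longrightarrow> x i = x' i"
    and t: "block_start \<sigma> x p \<le> t" "t < block_start \<sigma> x q"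
  shows "subst_seq \<sigma> x t = subst_seq \<sigma> x' t"
proof -
  define l where "l = nat (q - p)"
  have w: "factor_at x p l = factor_at x' p l" "factor_at x p (nat (-p)) = factor_at x' p (nat (-p))"
    using pq eq by (auto simp: factor_at_def l_def)
  have start: "block_start \<sigma> x p = block_start \<sigma> x' p"
    using w(2) block_start_add[of \<sigma> x p "nat (- p)"] block_start_add[of \<sigma> x' p "nat (- p)"] pq by simp
  define W where "W = subst_word \<sigma> (factor_at x p l)"
  have len: "block_start \<sigma> x q = block_start \<sigma> x p + int (length W)"
    using block_start_add[of \<sigma> x p l] pq by (simp add: l_def W_def)
  have "factor_at (subst_seq \<sigma> x) (block_start \<sigma> x p) (length W)
      = factor_at (subst_seq \<sigma> x') (block_start \<sigma> x p) (length W)"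
    using factor_at_subst_seq[of \<sigma> x p l] factor_at_subst_seq[of \<sigma> x' p l] ne
    by (simp add: W_def w start)
  then have "factor_at (subst_seq \<sigma> x) (block_start \<sigma> x p) (length W) ! nat (t - block_start \<sigma> x p)
      = factor_at (subst_seq \<sigma> x') (block_start \<sigma> x p) (length W) ! nat (t - block_start \<sigma> x p)"
    by simp
  then show ?thesis using t len by simp
qed

text \<open>Images of letters are non-empty, so the central windows of the image depend on central
  windows that are no wider.\<close>

lemma subst_seq_continuous:
  assumes ne: "\<And>i. \<sigma> (x i) \<noteq> []" "\<And>i. \<sigma> (x' i) \<noteq> []"
    and eq: "\<And>i. \<bar>i\<bar> \<le> \<bar>t\<bar> \<Longrightarrow> x i = x' i"
  shows "subst_seq \<sigma> x t = subst_seq \<sigma> x' t"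
proof (rule subst_seq_cong[where p = "- \<bar>t\<bar>" and q = "\<bar>t\<bar> + 1"])
  show "block_start \<sigma> x (- \<bar>t\<bar>) \<le> t"
    using block_start_diff_ge[of \<sigma> x "- \<bar>t\<bar>" 0] ne by simp
  show "t < block_start \<sigma> x (\<bar>t\<bar> + 1)"
    using block_start_diff_ge[of \<sigma> x 0 "\<bar>t\<bar> + 1"] ne by simp
qed (use assms in auto)

text \<open>The blocks of the composite are the \<open>\<rho>\<close>-images of the \<open>\<sigma>\<close>-blocks, and they start at the same
  coordinates on both sides.\<close>

lemma subst_seq_subst_seq:
  assumes ne: "\<And>i. \<sigma> (x i) \<noteq> []" "\<And>i. \<rho> (subst_seq \<sigma> x i) \<noteq> []"
    and ne': "\<And>i. subst_word \<rho> (\<sigma> (x i)) \<noteq> []"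
  shows "subst_seq \<rho> (subst_seq \<sigma> x) = subst_seq (\<lambda>a. subst_word \<rho> (\<sigma> a)) x"
proof
  fix t
  let ?\<pi> = "\<lambda>a. subst_word \<rho> (\<sigma> a)" and ?y = "subst_seq \<sigma> x"
  have step: "block_start \<rho> ?y (block_start \<sigma> x (p + int l)) - block_start \<rho> ?y (block_start \<sigma> x p)
      = block_start ?\<pi> x (p + int l) - block_start ?\<pi> x p" for p l
    by (simp add: block_start_add factor_at_subst_seq[of \<sigma> x, OF ne(1)] subst_word_subst_word)
  have start: "block_start \<rho> ?y (block_start \<sigma> x p) = block_start ?\<pi> x p" for p
  proof (cases "0 \<le> p")
    case True
    then show ?thesis using step[of 0 "nat p"] by simp
  next
    case False
    then show ?thesis using step[of p "nat (- p)"] by simp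
  qed
  obtain i j where ij: "t = block_start ?\<pi> x i + int j" "j < length (?\<pi> (x i))"
    using block_start_locate[of ?\<pi> x] ne' by blast
  have block: "factor_at ?y (block_start \<sigma> x i) (length (\<sigma> (x i))) = \<sigma> (x i)"
    using factor_at_subst_seq[of \<sigma> x i 1, OF ne(1)] by (simp add: subst_word_single)
  have "factor_at (subst_seq \<rho> ?y) (block_start ?\<pi> x i) (length (?\<pi> (x i))) = ?\<pi> (x i)"
    using factor_at_subst_seq[of \<rho> ?y "block_start \<sigma> x i" "length (\<sigma> (x i))", OF ne(2)]
    by (simp add: block start)
  then have "?\<pi> (x i) ! j = subst_seq \<rho> ?y t"
    using ij by (metis nth_factor_at)
  then show "subst_seq \<rho> ?y t = subst_seq ?\<pi> x t"
    using ij subst_seq_block[of ?\<pi> x, OF ne'] by simp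
qed

lemma subst_seq_before:
  assumes ne: "\<And>i. \<sigma> (x i) \<noteq> []"
  shows "subst_seq \<sigma> x (-1) = last (\<sigma> (x (-1)))"
proof -
  have "0 < length (\<sigma> (x (-1)))" using ne by simp
  moreover from this have "block_start \<sigma> x (-1) + int (length (\<sigma> (x (-1))) - 1) = -1"
    using block_start_Suc[of \<sigma> x "-1"] by (simp add: of_nat_diff Suc_le_eq)
  ultimately show ?thesis
    using subst_seq_block[of \<sigma> x "length (\<sigma> (x (-1))) - 1" "-1", OF ne] ne
    by (simp add: last_conv_nth)
qed

lemma subst_seq_after:
  assumes ne: "\<And>i. \<sigma> (x i) \<noteq> []"
  shows "subst_seq \<sigma> x (int (length (\<sigma> (x 0)))) = hd (\<sigma> (x 1))"
  using subst_seq_block[of \<sigma> x 0 1, OF ne] block_start_Suc[of \<sigma> x 0] ne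
  by (simp add: hd_conv_nth)

lemma range_subst_seq:
  assumes ne: "\<And>i. \<sigma> (x i) \<noteq> []" and "\<And>i. set (\<sigma> (x i)) \<subseteq> B"
  shows "range (subst_seq \<sigma> x) \<subseteq> B"
proof (rule image_subsetI)
  fix t
  obtain i j where "t = block_start \<sigma> x i + int j" "j < length (\<sigma> (x i))"
    using block_start_locate[of \<sigma> x, OF ne] by blast
  then show "subst_seq \<sigma> x t \<in> B"
    using subst_seq_block[of \<sigma> x, OF ne] assms(2) nth_mem by fastforce
qed

section \<open>Compactness\<close>

text \<open>The form of Tychonoff's theorem that replaces both sequential compactness of shift spaces and
  Koenig's lemma: the index set is \<open>\<int>\<close> for limits of points, and \<open>\<nat>\<close> for limits of addresses, where
  the finite set of values depends on the index.\<close>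

lemma cluster_point:
  fixes f :: "nat \<Rightarrow> 'i \<Rightarrow> 'b"
  assumes "\<And>i. finite (F i)" and "\<And>N i. f N i \<in> F i"
  shows "\<exists>g. (\<forall>i. g i \<in> F i) \<and> (\<forall>J M. finite J \<longrightarrow> (\<exists>N\<ge>M. \<forall>i\<in>J. f N i = g i))"
proof -
  let ?T = "product_topology (\<lambda>i. discrete_topology (F i)) UNIV"
  let ?C = "\<lambda>M. ?T closure_of (f ` {M..})"
  have top: "f N \<in> topspace ?T" for N using assms(2) by auto
  have "compact_space ?T"
    using assms(1) by (simp add: compact_space_product_topology compact_space_discrete_topology)
  moreover have "?C M \<noteq> {}" for M
    using top[of M] closure_of_subset[of "f ` {M..}" ?T] top by auto
  moreover have "decseq ?C"
    by (intro antimonoI closure_of_mono image_mono) auto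
  ultimately have "(\<Inter>M. ?C M) \<noteq> {}"
    by (intro compact_space_imp_nest) auto
  then obtain g where g: "\<And>M. g \<in> ?C M" by auto
  then have gF: "g i \<in> F i" for i
    using closure_of_subset_topspace[of ?T "f ` {0..}"] g[of 0] by auto
  have "\<exists>N\<ge>M. \<forall>i\<in>J. f N i = g i" if "finite J" for J M
  proof -
    let ?W = "\<Pi>\<^sub>E i\<in>UNIV. if i \<in> J then {g i} else F i"
    have "openin ?T ?W"
      unfolding openin_PiE_gen using that gF
      by (auto intro: finite_subset[of _ J] split: if_splits)
    moreover have "g \<in> ?W" using gF by (auto split: if_splits)
    ultimately obtain h where "h \<in> ?W" "h \<in> f ` {M..}"
      using g[of M] unfolding in_closure_of by blast
    then show ?thesis by (fastforce simp: PiE_iff split: if_splits)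
  qed
  with gF show ?thesis by blast
qed

section \<open>The levels of a directive sequence\<close>

lemma composite_ge [simp]: "m \<le> n \<Longrightarrow> composite \<tau> n m w = w"
  by (simp add: composite_def)

lemma composite_Suc: "n \<le> m \<Longrightarrow> composite \<tau> n (Suc m) w = composite \<tau> n m (subst_word (\<tau> m) w)"
  by (simp add: composite_def)

lemma composite_composite:
  "n \<le> m \<Longrightarrow> m \<le> p \<Longrightarrow> composite \<tau> n m (composite \<tau> m p w) = composite \<tau> n p w"
  using upt_add_eq_append[of n m "p - m"] by (simp add: composite_def)

lemma composite_Nil [simp]: "composite \<tau> n m [] = []"
proof (induction m)
  case (Suc m)
  then show ?case by (cases "n \<le> m") (simp_all add: composite_Suc)
qed simp

lemma composite_append: "composite \<tau> n m (v @ w) = composite \<tau> n m v @ composite \<tau> n m w"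
proof (induction m arbitrary: v w)
  case (Suc m)
  then show ?case by (cases "n \<le> m") (simp_all add: composite_Suc subst_word_append)
qed simp

lemma subst_word_composite_letter: "subst_word (composite_letter \<tau> n m) w = composite \<tau> n m w"
proof (induction w)
  case (Cons a w)
  then show ?case using composite_append[of \<tau> n m "[a]" w] by (simp add: subst_word_Cons)
qed simp

lemma composite_letter_Suc: "composite_letter \<tau> m (Suc m) = \<tau> m"
  by (simp add: composite_Suc subst_word_single)

locale directive =
  fixes A :: "nat \<Rightarrow> 'a set" and \<tau> :: "nat \<Rightarrow> 'a \<Rightarrow> 'a list"
  assumes directive: "directive_sequence A \<tau>"
begin

abbreviation "X \<equiv> level_shift A \<tau>"
abbreviation "img \<equiv> composite_letter \<tau>"

lemma finite_alphabet: "finite (A n)"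
  and alphabet_nonempty: "A n \<noteq> {}"
  using directive by (auto simp: directive_sequence_def alphabet_def dest!: spec[of _ n])

lemma letter_image:
  assumes "a \<in> A (Suc n)"
  shows "\<tau> n a \<noteq> []" "set (\<tau> n a) \<subseteq> A n"
  using directive assms by (auto simp: directive_sequence_def substitution_def)

lemma set_composite:
  assumes "n \<le> m" "set w \<subseteq> A m"
  shows "set (composite \<tau> n m w) \<subseteq> A n"
  using assms
proof (induction m arbitrary: w rule: dec_induct)
  case (step m)
  have "set (subst_word (\<tau> m) w) \<subseteq> A m"
    using step.prems letter_image(2) by (fastforce simp: subst_word_def)
  then show ?case using step by (simp add: composite_Suc)
qed simp

lemma img_nonempty:
  assumes "a \<in> A m"
  shows "img n m a \<noteq> []"
proof -
  have "w \<noteq> [] \<Longrightarrow> set w \<subseteq> A m \<Longrightarrow> composite \<tau> n m w \<noteq> []" for w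
  proof (induction m arbitrary: w)
    case (Suc m)
    have "set (subst_word (\<tau> m) w) \<subseteq> A m" "subst_word (\<tau> m) w \<noteq> []"
      using Suc.prems letter_image by (fastforce simp: subst_word_def neq_Nil_conv)+
    then show ?case using Suc by (cases "n \<le> m") (simp_all add: composite_Suc)
  qed simp
  with assms show ?thesis by simp
qed

lemma letter_occurs_deeper:
  assumes "n \<le> m" "b \<in> A n"
  shows "\<exists>a\<in>A m. b \<in> set (img n m a)"
  using assms(1)
proof (induction m rule: dec_induct)
  case base
  then show ?case using assms(2) by auto
next
  case (step m)
  then obtain a c where a: "a \<in> A m" "b \<in> set (img n m a)" and c: "c \<in> A (Suc m)" "a \<in> set (\<tau> m c)"
    using directive unfolding directive_sequence_def substitution_def by meson
  then obtain u v where "\<tau> m c = u @ [a] @ v" by (auto simp: in_set_conv_decomp)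
  then have "img n (Suc m) c = composite \<tau> n m u @ img n m a @ composite \<tau> n m v"
    using step by (simp add: composite_Suc subst_word_single flip: composite_append)
  then have "b \<in> set (img n (Suc m) c)"
    using a by simp
  with c show ?case by blast
qed

lemma composite_sublist: "sublist v w \<Longrightarrow> sublist (composite \<tau> n m v) (composite \<tau> n m w)"
  unfolding sublist_def by (metis composite_append)

text \<open>Since every letter occurs in the image of some letter one level up, the level at which a factor is
  witnessed can be raised at will.\<close>

lemma factor_occurs_deeper:
  assumes "n \<le> m" "m \<le> p" "a \<in> A m" "sublist w (img n m a)"
  shows "\<exists>b\<in>A p. sublist w (img n p b)"
proof -
  obtain b where b: "b \<in> A p" "a \<in> set (img m p b)"
    using letter_occurs_deeper assms by blast
  then have "sublist [a] (img m p b)" by (simp add: sublist_def) (metis append_Cons append_Nil split_list)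
  from composite_sublist[OF this, of n m] have "sublist (img n m a) (img n p b)"
    using assms by (simp add: composite_composite)
  with assms b show ?thesis using sublist_order.order_trans by blast
qed

lemma level_shift_iff:
  "x \<in> X n \<longleftrightarrow> range x \<subseteq> A n \<and> (\<forall>p l. \<exists>m>n. \<exists>a\<in>A m. sublist (factor_at x p l) (img n m a))"
  unfolding level_shift_def factors_eq by blast

lemma level_shift_letter: "x \<in> X n \<Longrightarrow> x i \<in> A n"
  by (auto simp: level_shift_iff)

lemma level_shift_image_nonempty: "x \<in> X m \<Longrightarrow> img n m (x i) \<noteq> []"
  by (simp add: img_nonempty level_shift_letter)

lemma level_shift_image_nonempty': "x \<in> X (Suc m) \<Longrightarrow> \<tau> m (x i) \<noteq> []"
  by (simp add: letter_image level_shift_letter)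

lemma level_shift_translate: "x \<in> X n \<Longrightarrow> (\<lambda>i. x (i + c)) \<in> X n"
  unfolding level_shift_iff factor_at_translate by auto

text \<open>Membership is a condition on finite windows, so the level shifts are closed.\<close>

lemma level_shift_closed:
  assumes "\<And>M. \<exists>z\<in>X n. \<forall>i\<in>{- int M..int M}. z i = x i"
  shows "x \<in> X n"
  unfolding level_shift_iff
proof (intro conjI allI)
  have "x i \<in> A n" for i
  proof -
    obtain z where "z \<in> X n" "\<forall>j\<in>{- \<bar>i\<bar>..\<bar>i\<bar>}. z j = x j" using assms[of "nat \<bar>i\<bar>"] by auto
    moreover have "i \<in> {- \<bar>i\<bar>..\<bar>i\<bar>}" by auto
    ultimately show ?thesis using level_shift_letter by metis
  qed
  then show "range x \<subseteq> A n" by auto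
next
  fix p l
  define M where "M = nat (\<bar>p\<bar> + int l)"
  obtain z where z: "z \<in> X n" "\<forall>i\<in>{- int M..int M}. z i = x i" using assms by blast
  have "x (p + int j) = z (p + int j)" if "j < l" for j
    by (rule bspec[OF z(2), symmetric]) (use that in \<open>auto simp: M_def\<close>)
  then have "factor_at x p l = factor_at z p l"
    by (simp add: factor_at_def)
  with z show "\<exists>m>n. \<exists>a\<in>A m. sublist (factor_at x p l) (img n m a)"
    by (auto simp: level_shift_iff)
qed

lemma subst_seq_level_shift:
  assumes "n \<le> m" "x \<in> X m"
  shows "subst_seq (img n m) x \<in> X n"
  unfolding level_shift_iff
proof (intro conjI allI)
  let ?\<sigma> = "img n m"
  have ne: "?\<sigma> (x i) \<noteq> []" for i using assms level_shift_image_nonempty by blast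
  show "range (subst_seq ?\<sigma> x) \<subseteq> A n"
  proof (rule range_subst_seq)
    show "set (?\<sigma> (x i)) \<subseteq> A n" for i
      using set_composite[of n m "[x i]"] assms level_shift_letter by simp
  qed (rule ne)
  fix p l
  define M where "M = nat (\<bar>p\<bar> + int l)"
  define w where "w = factor_at x (- int M) (2 * M)"
  have "block_start ?\<sigma> x (- int M) \<le> - int M" "int M \<le> block_start ?\<sigma> x (int M)"
    using block_start_diff_ge[of ?\<sigma> x "- int M" 0] block_start_diff_ge[of ?\<sigma> x 0 "int M"] ne by simp_all
  moreover have "block_start ?\<sigma> x (int M) = block_start ?\<sigma> x (- int M) + int (length (subst_word ?\<sigma> w))"
    using block_start_add[of ?\<sigma> x "- int M" "2 * M"] by (simp add: w_def)
  ultimately have "sublist (factor_at (subst_seq ?\<sigma> x) p l)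
      (factor_at (subst_seq ?\<sigma> x) (block_start ?\<sigma> x (- int M)) (length (subst_word ?\<sigma> w)))"
    by (intro factor_at_sublist) (auto simp: M_def)
  then have "sublist (factor_at (subst_seq ?\<sigma> x) p l) (composite \<tau> n m w)"
    unfolding w_def using factor_at_subst_seq[of ?\<sigma> x, OF ne] by (simp add: subst_word_composite_letter)
  moreover obtain q a where "q > m" "a \<in> A q" "sublist w (img m q a)"
    using assms(2) unfolding level_shift_iff w_def by blast
  moreover from this have "sublist (composite \<tau> n m w) (img n q a)"
    using composite_sublist[of w "img m q a" n m] assms(1) by (simp add: composite_composite)
  ultimately show "\<exists>q>n. \<exists>a\<in>A q. sublist (factor_at (subst_seq ?\<sigma> x) p l) (img n q a)"
    using assms(1) by (meson order_le_less_trans sublist_order.order_trans)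
qed

lemma subst_seq_img_composite:
  assumes "n \<le> p" "p \<le> m" "x \<in> X m"
  shows "subst_seq (img n m) x = subst_seq (img n p) (subst_seq (img p m) x)"
proof -
  have eq: "img n m = (\<lambda>a. subst_word (img n p) (img p m a))"
    using assms by (simp add: composite_composite subst_word_composite_letter)
  have "subst_seq (img p m) x \<in> X p"
    using subst_seq_level_shift assms by simp
  moreover have "subst_word (img n p) (img p m (x i)) \<noteq> []" for i
    using level_shift_image_nonempty[of x m n i] assms by (metis eq)
  ultimately show ?thesis unfolding eq
    using assms by (intro subst_seq_subst_seq[symmetric]) (auto simp: level_shift_image_nonempty)
qed

section \<open>Levels of towers\<close>

definition tower_level :: "nat \<Rightarrow> nat \<Rightarrow> 'a \<Rightarrow> nat \<Rightarrow> (int \<Rightarrow> 'a) set" where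
  "tower_level n m a k = (shift ^^ k) ` base A \<tau> n m a"

lemma tower_level_iff:
  "y \<in> tower_level n m a k \<longleftrightarrow> (\<exists>x\<in>X m. x 0 = a \<and> y = (\<lambda>i. subst_seq (img n m) x (i + int k)))"
  unfolding tower_level_def base_def by (auto simp: shift_power)

lemma tower_level_subset_level_shift: "n \<le> m \<Longrightarrow> tower_level n m a k \<subseteq> X n"
proof
  fix y assume "n \<le> m" "y \<in> tower_level n m a k"
  then show "y \<in> X n"
    unfolding tower_level_iff using subst_seq_level_shift level_shift_translate by blast
qed

text \<open>A continuous image of a compact set: preimages of the approximating points have a cluster point,
  and \<open>subst_seq_continuous\<close> carries the limit over.\<close>

lemma tower_level_closed:
  assumes "\<And>M. \<exists>z\<in>tower_level n m a k. \<forall>i\<in>{- int M..int M}. z i = y i"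
  shows "y \<in> tower_level n m a k"
proof -
  let ?\<sigma> = "img n m"
  have "\<exists>x. x \<in> X m \<and> x 0 = a \<and> (\<forall>i\<in>{- int M..int M}. y i = subst_seq ?\<sigma> x (i + int k))" for M
  proof -
    obtain z where "z \<in> tower_level n m a k" "\<forall>i\<in>{- int M..int M}. z i = y i" using assms by blast
    then show ?thesis unfolding tower_level_iff by metis
  qed
  then obtain x where x: "\<And>M. x M \<in> X m" "\<And>M. x M 0 = a"
      "\<And>M i. i \<in> {- int M..int M} \<Longrightarrow> y i = subst_seq ?\<sigma> (x M) (i + int k)"
    by metis
  have "\<exists>g. (\<forall>i. g i \<in> A m) \<and> (\<forall>J M. finite J \<longrightarrow> (\<exists>N\<ge>M. \<forall>i\<in>J. x N i = g i))"
    by (rule cluster_point) (use finite_alphabet x(1) level_shift_letter in auto)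
  then obtain g where g: "\<And>J M. finite J \<Longrightarrow> \<exists>N\<ge>M. \<forall>i\<in>J. x N i = g i" by blast
  have "g \<in> X m"
    by (rule level_shift_closed) (use g x(1) in \<open>meson finite_atLeastAtMost_int\<close>)
  moreover have "g 0 = a" using g[of "{0}" 0] x(2) by auto
  moreover have "y i = subst_seq ?\<sigma> g (i + int k)" for i
  proof -
    obtain N where N: "N \<ge> nat \<bar>i\<bar>" "\<forall>j\<in>{- \<bar>i + int k\<bar>..\<bar>i + int k\<bar>}. x N j = g j"
      using g by blast
    then have "y i = subst_seq ?\<sigma> (x N) (i + int k)" by (intro x(3)) auto
    also have "\<dots> = subst_seq ?\<sigma> g (i + int k)"
    proof (rule subst_seq_continuous)
      show "x N j = g j" if "\<bar>j\<bar> \<le> \<bar>i + int k\<bar>" for j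
        by (rule bspec[OF N(2)]) (use that in auto)
    qed (use \<open>g \<in> X m\<close> x(1) level_shift_image_nonempty in auto)
    finally show ?thesis .
  qed
  ultimately show ?thesis unfolding tower_level_iff by blast
qed

text \<open>Coordinate \<open>|u|\<close> of \<open>\<tau>\<^sub>m(x)\<close> carries the letter \<open>c\<close> when \<open>x 0 = b\<close>, so shifting \<open>\<tau>\<^sub>m(x)\<close> by \<open>|u|\<close> gives a
  preimage at level \<open>m\<close> that starts with \<open>c\<close>.\<close>

lemma tower_level_nested:
  assumes "n \<le> m" "\<tau> m b = u @ c # v"
  shows "tower_level n (Suc m) b (length (composite \<tau> n m u) + k) \<subseteq> tower_level n m c k"
proof
  fix y assume "y \<in> tower_level n (Suc m) b (length (composite \<tau> n m u) + k)"
  then obtain x where x: "x \<in> X (Suc m)" "x 0 = b"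
      and y: "y = (\<lambda>i. subst_seq (img n (Suc m)) x (i + int (length (composite \<tau> n m u) + k)))"
    unfolding tower_level_iff by blast
  define z where "z = subst_seq (\<tau> m) x"
  have zX: "z \<in> X m"
    using subst_seq_level_shift[of m "Suc m" x] x by (simp add: composite_letter_Suc z_def)
  have z: "z (int j) = (u @ c # v) ! j" if "j < length (u @ c # v)" for j
    using subst_seq_block[of "\<tau> m" x j 0] x level_shift_image_nonempty' that assms(2) by (simp add: z_def)
  have "factor_at z 0 (length u) = u"
    by (rule nth_equalityI) (auto simp: z nth_append)
  then have bs: "block_start (img n m) z (int (length u)) = int (length (composite \<tau> n m u))"
    by (simp add: block_start_def subst_word_composite_letter)
  have "y = (\<lambda>i. subst_seq (img n m) (\<lambda>i. z (i + int (length u))) (i + int k))"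
    unfolding y subst_seq_img_composite[OF assms(1) le_SucI[OF order_refl] x(1)] composite_letter_Suc z_def[symmetric]
    by (subst subst_seq_translate) (use zX level_shift_image_nonempty in \<open>auto simp: bs algebra_simps\<close>)
  moreover have "(\<lambda>i. z (i + int (length u))) \<in> X m" using zX level_shift_translate by blast
  moreover have "z (int (length u)) = c" by (simp add: z)
  ultimately show "y \<in> tower_level n m c k" unfolding tower_level_iff by (intro bexI) auto
qed

lemma bounded_image_length: "\<exists>L>0. \<forall>a\<in>A m. length (img n m a) \<le> L"
proof (intro exI conjI ballI)
  show "length (img n m a) \<le> Suc (Max ((\<lambda>a. length (img n m a)) ` A m))" if "a \<in> A m" for a
    using that finite_alphabet by (intro le_SucI Max_ge) auto
qed simp

text \<open>Finite approximation for \<open>point_in_tower_level\<close>. A central window of \<open>x\<close> occurs in the image of a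
  word \<open>v\<close> that itself occurs in an image of a deeper letter. The sequence \<open>z\<close> is \<open>v\<close>, placed so that the
  letter whose image contains coordinate \<open>0\<close> of \<open>x\<close> sits at the origin, and padded arbitrarily. As
  images of letters have length at most \<open>L\<close>, about \<open>M / L\<close> letters on each side of the origin belong
  to \<open>v\<close> and are not padding.\<close>

lemma level_shift_window:
  assumes nm: "n < m" and x: "x \<in> X n" and L: "\<And>a. a \<in> A m \<Longrightarrow> length (img n m a) \<le> L" "L > 0"
  shows "\<exists>z k. (\<forall>i. z i \<in> A m) \<and> k < length (img n m (z 0)) \<and>
      (\<forall>t\<in>{- int M..int M}. x t = subst_seq (img n m) z (t + int k)) \<and>
      (\<forall>l. L * Suc l \<le> M \<longrightarrow> (\<exists>q>m. \<exists>a\<in>A q. sublist (factor_at z (- int l) (2 * l + 1)) (img m q a)))"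
proof -
  let ?\<sigma> = "img n m"
  define w where "w = factor_at x (- int M) (2 * M + 1)"
  obtain q0 a0 where "a0 \<in> A q0" "q0 > n" "sublist w (img n q0 a0)"
    using x unfolding level_shift_iff w_def by blast
  then obtain q a where q: "q > m" "a \<in> A q" "sublist w (img n q a)"
    using factor_occurs_deeper[of n q0 "max q0 (Suc m)" a0 w] by (auto simp: less_max_iff_disj) (metis less_max_iff_disj lessI)
  define v where "v = img m q a"
  have v: "set v \<subseteq> A m" using set_composite[of m q "[a]"] q by (simp add: v_def)
  have "sublist w (subst_word ?\<sigma> v)"
    using q nm by (simp add: v_def subst_word_composite_letter composite_composite)
  then obtain ps ss where vw: "subst_word ?\<sigma> v = ps @ w @ ss" by (auto simp: sublist_def)
  have lw: "length w = 2 * M + 1" by (simp add: w_def)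
  have len: "length (subst_word ?\<sigma> v) = length ps + (2 * M + 1) + length ss" by (simp add: vw lw)
  then obtain u c v' k where c: "v = u @ c # v'" "length ps + M = length (subst_word ?\<sigma> u) + k"
      "k < length (?\<sigma> c)"
    using subst_word_locate[of "length ps + M" ?\<sigma> v] by auto
  obtain d where d: "d \<in> A m" using alphabet_nonempty by blast
  \<comment> \<open>The letter c = v ! length u moves to coordinate 0; d is the padding.\<close>
  define z where "z = (\<lambda>i. if - int (length u) \<le> i \<and> i < int (length v) - int (length u)
      then v ! nat (i + int (length u)) else d)"
  have zA: "z i \<in> A m" for i
  proof (cases "- int (length u) \<le> i \<and> i < int (length v) - int (length u)")
    case True
    then have "v ! nat (i + int (length u)) \<in> set v" by (intro nth_mem) auto
    with v True show ?thesis by (auto simp: z_def)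
  qed (use d in \<open>auto simp: z_def\<close>)
  then have ne: "?\<sigma> (z i) \<noteq> []" for i using img_nonempty by blast
  have z0: "z 0 = c" by (simp add: z_def c)
  have fv: "factor_at z (- int (length u)) (length v) = v"
    by (rule nth_equalityI) (auto simp: z_def)
  have fu: "factor_at z (- int (length u)) (length u) = u"
    by (rule nth_equalityI) (auto simp: z_def c nth_append)
  have bs: "block_start ?\<sigma> z (- int (length u)) = - int (length (subst_word ?\<sigma> u))"
    using block_start_add[of ?\<sigma> z "- int (length u)" "length u"] by (simp add: fu)
  have image: "factor_at (subst_seq ?\<sigma> z) (- int (length (subst_word ?\<sigma> u))) (length (subst_word ?\<sigma> v))
      = subst_word ?\<sigma> v"
    using factor_at_subst_seq[of ?\<sigma> z "- int (length u)" "length v", OF ne] by (simp add: fv bs)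
  have "x t = subst_seq ?\<sigma> z (t + int k)" if t: "t \<in> {- int M..int M}" for t
  proof -
    define j where "j = nat (t + int M)"
    have j: "j < 2 * M + 1" "t = int j - int M" using t by (auto simp: j_def)
    have "subst_seq ?\<sigma> z (t + int k) = factor_at (subst_seq ?\<sigma> z)
        (- int (length (subst_word ?\<sigma> u))) (length (subst_word ?\<sigma> v)) ! (length ps + j)"
      using j c(2) by (subst nth_factor_at) (auto simp: len intro!: arg_cong[of _ _ "subst_seq ?\<sigma> z"])
    also have "\<dots> = w ! j" unfolding image unfolding vw using j by (simp add: nth_append lw)
    also have "\<dots> = x t" using j by (simp add: w_def)
    finally show ?thesis by simp
  qed
  moreover have "\<exists>q>m. \<exists>a\<in>A q. sublist (factor_at z (- int l) (2 * l + 1)) (img m q a)"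
    if l: "L * Suc l \<le> M" for l
  proof -
    \<comment> \<open>To the left of the origin: u has more than l letters, because its image is too long otherwise.\<close>
    have k: "k < L" using c(3) L(1)[of c] zA[of 0] z0 by simp
    have bound: "length (subst_word ?\<sigma> u') \<le> L * length u'" if "set u' \<subseteq> A m" for u'
      using that L by (intro length_subst_word_le) auto
    have "L * Suc l \<le> length (subst_word ?\<sigma> u) + k" using l c(2) by linarith
    also have "\<dots> < L * length u + L" using bound[of u] v c(1) k by simp
    finally have "L * Suc l < L * Suc (length u)" by simp
    then have lu: "l \<le> length u" using L(2) by (simp only: mult_less_cancel1) simp
    \<comment> \<open>To the right: the same count for the part of v from c on.\<close>
    have "length (subst_word ?\<sigma> v) = length (subst_word ?\<sigma> u) + length (subst_word ?\<sigma> (c # v'))"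
      by (simp add: c(1) subst_word_append)
    then have "M < length (subst_word ?\<sigma> (c # v'))" using c(2) len by linarith
    also have "\<dots> \<le> L * Suc (length v')" using bound[of "c # v'"] v c(1) by simp
    finally have "L * Suc l < L * Suc (length v')" using l by linarith
    then have lv: "l \<le> length v'" using L(2) by (simp only: mult_less_cancel1) simp
    have "sublist (factor_at z (- int l) (2 * l + 1)) (factor_at z (- int (length u)) (length v))"
      using lu lv c(1) by (intro factor_at_sublist) auto
    then show ?thesis unfolding fv unfolding v_def using q by blast
  qed
  ultimately show ?thesis using zA c(3) z0 by metis
qed

text \<open>Desubstitution: the approximate preimages accumulate at an exact one. The letters of the word \<open>v\<close>
  behind \<open>level_shift_window\<close> need not occur in points of the level \<open>m\<close> shift, so a limit is needed
  already to obtain some point of it.\<close>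

lemma point_in_tower_level:
  assumes nm: "n < m" and x: "x \<in> X n"
  shows "\<exists>a\<in>A m. \<exists>k<length (img n m a). x \<in> tower_level n m a k"
proof -
  let ?\<sigma> = "img n m"
  obtain L where L: "L > 0" "\<And>a. a \<in> A m \<Longrightarrow> length (img n m a) \<le> L"
    using bounded_image_length by blast
  obtain z k where z: "\<And>M i. z M i \<in> A m" "\<And>M. k M < length (?\<sigma> (z M 0))"
    "\<And>M t. t \<in> {- int M..int M} \<Longrightarrow> x t = subst_seq ?\<sigma> (z M) (t + int (k M))"
    "\<And>M l. L * Suc l \<le> M \<Longrightarrow>
        \<exists>q>m. \<exists>a\<in>A q. sublist (factor_at (z M) (- int l) (2 * l + 1)) (img m q a)"
    using level_shift_window[OF nm x L(2,1)] by metis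
  have kL: "k M < L" for M using z(2)[of M] L(2)[OF z(1)[of M 0]] by linarith
  \<comment> \<open>The offset k M is carried along in every coordinate, so that it stabilises too.\<close>
  define f where "f = (\<lambda>M i. (z M i, k M))"
  have "\<exists>g. (\<forall>i. g i \<in> A m \<times> {..<L}) \<and> (\<forall>J M. finite J \<longrightarrow> (\<exists>N\<ge>M. \<forall>i\<in>J. f N i = g i))"
    by (rule cluster_point) (use finite_alphabet z(1) kL in \<open>auto simp: f_def\<close>)
  then obtain g where g: "\<And>i. g i \<in> A m \<times> {..<L}"
      "\<And>J M. finite J \<Longrightarrow> \<exists>N\<ge>M. \<forall>i\<in>J. f N i = g i" by blast
  define y where "y = fst \<circ> g"
  define h where "h = snd (g 0)"
  have near: "\<exists>N\<ge>M. k N = h \<and> (\<forall>i\<in>J. z N i = y i)" if J: "finite J" for J M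
  proof -
    obtain N where N: "N \<ge> M" "\<forall>i\<in>insert 0 J. f N i = g i"
      using g(2)[of "insert 0 J" M] J by blast
    then have "k N = snd (g 0)" "\<forall>i\<in>J. z N i = fst (g i)"
      by (auto simp: f_def simp flip: prod.expand) (metis fst_conv insertCI snd_conv)+
    with N(1) show ?thesis by (auto simp: y_def h_def)
  qed
  have yA: "y i \<in> A m" for i using g(1)[of i] by (auto simp: y_def)
  have "y \<in> X m"
    unfolding level_shift_iff
  proof (intro conjI allI)
    show "range y \<subseteq> A m" using yA by auto
    fix p l
    define r where "r = nat (\<bar>p\<bar> + int l)"
    obtain N where N: "N \<ge> L * Suc r" "\<forall>i\<in>{- int r..int r}. z N i = y i"
      using near[of "{- int r..int r}"] by blast
    have "y (p + int j) = z N (p + int j)" if "j < l" for j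
      by (rule bspec[OF N(2), symmetric]) (use that in \<open>auto simp: r_def\<close>)
    then have "factor_at y p l = factor_at (z N) p l" by (simp add: factor_at_def)
    moreover have "sublist (factor_at (z N) p l) (factor_at (z N) (- int r) (2 * r + 1))"
      by (rule factor_at_sublist) (auto simp: r_def)
    ultimately show "\<exists>q>m. \<exists>a\<in>A q. sublist (factor_at y p l) (img m q a)"
      using z(4)[OF N(1)] sublist_order.order_trans by metis
  qed
  have "x t = subst_seq ?\<sigma> y (t + int h)" for t
  proof -
    obtain N where N: "N \<ge> nat \<bar>t\<bar>" "k N = h" "\<forall>j\<in>{- \<bar>t + int h\<bar>..\<bar>t + int h\<bar>}. z N j = y j"
      using near[of "{- \<bar>t + int h\<bar>..\<bar>t + int h\<bar>}"] by blast
    have "t \<in> {- int N..int N}" using N(1) by auto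
    then have "x t = subst_seq ?\<sigma> (z N) (t + int h)" using z(3)[of t N] N(2) by simp
    also have "\<dots> = subst_seq ?\<sigma> y (t + int h)"
    proof (rule subst_seq_continuous)
      show "z N j = y j" if "\<bar>j\<bar> \<le> \<bar>t + int h\<bar>" for j
        by (rule bspec[OF N(3)]) (use that in auto)
    qed (use z(1) yA img_nonempty in auto)
    finally show ?thesis .
  qed
  moreover obtain N where "k N = h" "z N 0 = y 0" using near[of "{0}" 0] by auto
  ultimately show ?thesis
    using z(2)[of N] \<open>y \<in> X m\<close> yA[of 0] unfolding tower_level_iff by (metis ext)
qed

section \<open>Addresses\<close>

definition address_shift :: "(nat \<Rightarrow> 'a list) \<Rightarrow> nat \<Rightarrow> nat \<Rightarrow> nat" where
  "address_shift u n m = (\<Sum>j = n..<m. length (composite \<tau> n j (u j)))"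

lemma address_shift_Suc:
  "n \<le> m \<Longrightarrow> address_shift u n (Suc m) = address_shift u n m + length (composite \<tau> n m (u m))"
  by (simp add: address_shift_def)

text \<open>The point \<open>S\<^sup>s \<tau>\<^sub>n\<^sub>m(x)\<close> with \<open>x 0 = a m\<close> has its origin inside the block of \<open>a m\<close>, so the sets attached to
  an address are members of the covers.\<close>

lemma address_shift_less:
  assumes "\<And>j. j < m \<Longrightarrow> prefix (u j @ [a j]) (\<tau> j (a (Suc j)))" "n \<le> m"
  shows "address_shift u n m < length (img n m (a m))"
  using assms(2,1)
proof (induction m rule: dec_induct)
  case base
  then show ?case by (simp add: address_shift_def)
next
  case (step m)
  then obtain v where "\<tau> m (a (Suc m)) = u m @ [a m] @ v" by (auto simp: prefix_def)
  then have "img n (Suc m) (a (Suc m)) = composite \<tau> n m (u m) @ img n m (a m) @ composite \<tau> n m v"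
    using step by (simp add: composite_Suc subst_word_single flip: composite_append)
  with step show ?case by (simp add: address_shift_Suc)
qed

lemma address_tower_nested:
  assumes "\<And>j. j < m' \<Longrightarrow> prefix (u j @ [a j]) (\<tau> j (a (Suc j)))" "n \<le> m" "m \<le> m'"
  shows "tower_level n m' (a m') (address_shift u n m') \<subseteq> tower_level n m (a m) (address_shift u n m)"
  using assms(3,1)
proof (induction m' rule: dec_induct)
  case (step m')
  then have "prefix (u m' @ [a m']) (\<tau> m' (a (Suc m')))" by blast
  then obtain v where "\<tau> m' (a (Suc m')) = u m' @ a m' # v" by (auto simp: prefix_def)
  from tower_level_nested[of n m', OF _ this, of "address_shift u n m'"] step assms(2)
  have "tower_level n (Suc m') (a (Suc m')) (address_shift u n (Suc m')) \<subseteq>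
      tower_level n m' (a m') (address_shift u n m')"
    by (simp add: address_shift_Suc add.commute)
  with step show ?case by fastforce
qed simp

text \<open>A position inside \<open>\<tau>\<^sub>n\<^sub>M(b)\<close> is traced through all the intermediate levels: at each of them it lies in
  the image of one letter of \<open>\<tau>\<^sub>j(a\<^sub>j\<^sub>+\<^sub>1)\<close>, and \<open>u\<^sub>j\<close> is what precedes this letter. Below level \<open>n\<close> the first
  letter is always chosen; there the composite is the identity and the position is \<open>0\<close>.\<close>

lemma address_exists:
  assumes "b \<in> A M" "k < length (img n M b)"
  shows "\<exists>u a. a M = b \<and> address_shift u n M = k \<and>
    (\<forall>j<M. prefix (u j @ [a j]) (\<tau> j (a (Suc j)))) \<and> (\<forall>j\<le>M. a j \<in> A j)"
  using assms
proof (induction M arbitrary: b k)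
  case 0
  then show ?case
    by (intro exI[of _ "\<lambda>_. []"] exI[of _ "\<lambda>_. b"]) (auto simp: address_shift_def)
next
  case (Suc M)
  have "\<exists>v c w k'. \<tau> M b = v @ c # w \<and> k' < length (img n M c) \<and>
      k = (if n \<le> M then length (composite \<tau> n M v) + k' else k')"
  proof (cases "n \<le> M")
    case True
    with Suc.prems have "k < length (subst_word (img n M) (\<tau> M b))"
      by (simp add: composite_Suc subst_word_single subst_word_composite_letter)
    from subst_word_locate[OF this] True show ?thesis by (auto simp: subst_word_composite_letter)
  next
    case False
    with Suc.prems have "k = 0" by simp
    moreover obtain c w where "\<tau> M b = c # w" using letter_image(1)[OF Suc.prems(1)] by (auto simp: neq_Nil_conv)
    ultimately show ?thesis using False by (intro exI[of _ "[]"] exI[of _ c] exI[of _ w] exI[of _ 0]) simp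
  qed
  then obtain v c w k' where c: "\<tau> M b = v @ c # w" "k' < length (img n M c)"
      "k = (if n \<le> M then length (composite \<tau> n M v) + k' else k')" by blast
  have "c \<in> A M" using letter_image(2)[OF Suc.prems(1)] c(1) by auto
  from Suc.IH[OF this c(2)] obtain u a where
    ua: "a M = c" "address_shift u n M = k'" "\<forall>j<M. prefix (u j @ [a j]) (\<tau> j (a (Suc j)))"
      "\<forall>j\<le>M. a j \<in> A j" by blast
  define u' a' where "u' = u(M := v)" and "a' = a(Suc M := b)"
  have "address_shift u' n M = k'"
    unfolding ua(2)[symmetric] address_shift_def by (intro sum.cong) (auto simp: u'_def)
  then have "address_shift u' n (Suc M) = k"
    using c(3) by (cases "n \<le> M") (auto simp: address_shift_Suc u'_def, simp add: address_shift_def)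
  moreover have "prefix (u' j @ [a' j]) (\<tau> j (a' (Suc j)))" if "j < Suc M" for j
    using that ua c(1) by (auto simp: less_Suc_eq u'_def a'_def)
  moreover have "a' (Suc M) = b" "\<forall>j\<le>Suc M. a' j \<in> A j"
    using ua(4) Suc.prems(1) by (auto simp: le_Suc_eq a'_def)
  ultimately show ?case by blast
qed

lemma letter_in_language_iff: "[a] \<in> language (X m) \<longleftrightarrow> (\<exists>x\<in>X m. x 0 = a)"
proof
  assume "[a] \<in> language (X m)"
  then obtain x p l where x: "x \<in> X m" "[a] = factor_at x p l"
    unfolding language_def factors_eq by blast
  have "l = length [a]" unfolding x(2) by simp
  with x level_shift_translate[of x m p] show "\<exists>x\<in>X m. x 0 = a"
    by (intro bexI[of _ "\<lambda>i. x (i + p)"]) auto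
next
  assume "\<exists>x\<in>X m. x 0 = a"
  then obtain x where "x \<in> X m" "[a] = factor_at x 0 1" by auto
  then show "[a] \<in> language (X m)" unfolding language_def factors_eq by blast
qed

text \<open>Non-emptiness depends on neither \<open>n\<close> nor \<open>k\<close>; this lets the language condition on addresses be
  transferred between levels.\<close>

lemma tower_level_nonempty_iff: "tower_level n m a k \<noteq> {} \<longleftrightarrow> [a] \<in> language (X m)"
  unfolding letter_in_language_iff by (auto simp: tower_level_def base_def)

lemma pair_in_language_iff: "[a, b] \<in> language (X m) \<longleftrightarrow> (\<exists>x\<in>X m. x 0 = a \<and> x 1 = b)"
proof
  assume "[a, b] \<in> language (X m)"
  then obtain x p l where x: "x \<in> X m" "[a, b] = factor_at x p l"
    unfolding language_def factors_eq by blast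
  have "l = length [a, b]" unfolding x(2) by simp
  with x have "x p = a" "x (p + 1) = b" by (simp_all add: factor_at_def numeral_2_eq_2)
  with x level_shift_translate[of x m p] show "\<exists>x\<in>X m. x 0 = a \<and> x 1 = b"
    by (intro bexI[of _ "\<lambda>i. x (i + p)"]) (auto simp: add.commute)
next
  assume "\<exists>x\<in>X m. x 0 = a \<and> x 1 = b"
  then obtain x where "x \<in> X m" "[a, b] = factor_at x 0 2" by (auto simp: factor_at_def numeral_2_eq_2)
  then show "[a, b] \<in> language (X m)" unfolding language_def factors_eq by blast
qed

text \<open>Cantor's intersection theorem, in the sharper form that the common point can be chosen as a cluster
  point of a given sequence of points of the sets.\<close>

lemma address_limit:
  assumes pre: "\<And>j. prefix (u j @ [a j]) (\<tau> j (a (Suc j)))"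
    and z: "\<And>m. n < m \<Longrightarrow> z m \<in> tower_level n m (a m) (address_shift u n m)"
  shows "\<exists>y. (\<forall>m>n. y \<in> tower_level n m (a m) (address_shift u n m)) \<and>
    (\<forall>M. \<exists>m>n. \<forall>i\<in>{- int M..int M}. z m i = y i)"
proof -
  define f where "f M = z (Suc n + M)" for M
  have f: "f M \<in> tower_level n m (a m) (address_shift u n m)" if "n \<le> m" "m \<le> Suc n + M" for M m
    using z[of "Suc n + M"] address_tower_nested[OF pre that] by (auto simp: f_def)
  have "f M i \<in> A n" for M i
    using f[of n M] tower_level_subset_level_shift[of n n] level_shift_letter by fastforce
  then have "\<exists>g. (\<forall>i. g i \<in> A n) \<and> (\<forall>J M. finite J \<longrightarrow> (\<exists>N\<ge>M. \<forall>i\<in>J. f N i = g i))"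
    by (intro cluster_point) (use finite_alphabet in auto)
  then obtain g where g: "\<And>J M. finite J \<Longrightarrow> \<exists>N\<ge>M. \<forall>i\<in>J. f N i = g i" by blast
  have "g \<in> tower_level n m (a m) (address_shift u n m)" if "n < m" for m
  proof (rule tower_level_closed)
    fix M
    obtain N where "N \<ge> m" "\<forall>i\<in>{- int M..int M}. f N i = g i"
      using g[of "{- int M..int M}" m] by auto
    then show "\<exists>z\<in>tower_level n m (a m) (address_shift u n m). \<forall>i\<in>{- int M..int M}. z i = g i"
      using f[of m N] that by auto
  qed
  moreover have "\<exists>m>n. \<forall>i\<in>{- int M..int M}. z m i = g i" for M
  proof -
    obtain N where "\<forall>i\<in>{- int M..int M}. f N i = g i"
      using g[of "{- int M..int M}" 0] by auto
    then show ?thesis by (intro exI[of _ "Suc n + N"]) (auto simp: f_def)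
  qed
  ultimately show ?thesis by blast
qed

section \<open>Narrow towers\<close>

definition narrow :: "nat \<Rightarrow> nat \<Rightarrow> nat \<Rightarrow> bool" where
  "narrow n m N \<longleftrightarrow> (\<forall>a\<in>A m. \<forall>k<length (img n m a). \<forall>y\<in>tower_level n m a k. \<forall>y'\<in>tower_level n m a k.
     \<forall>i\<in>{- int N..int N}. y i = y' i)"

definition narrowing :: bool where
  "narrowing \<longleftrightarrow> (\<forall>n N. \<exists>m>n. narrow n m N)"

text \<open>The condition that decisiveness imposes on a single substitution, here on \<open>\<tau>\<^sub>p\<^sub>m\<close>.\<close>

definition decisive_step :: "nat \<Rightarrow> nat \<Rightarrow> bool" where
  "decisive_step p m \<longleftrightarrow> (\<exists>l r. l \<in> A m \<rightarrow> A p \<and> r \<in> A m \<rightarrow> A p \<and>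
     (\<forall>a\<in>A m. \<forall>b\<in>A m. [a, b] \<in> language (X m) \<longrightarrow>
        prefix [r a] (img p m b) \<and> suffix [l b] (img p m a)))"

text \<open>Growth is assumed at level \<open>0\<close>; it passes to level \<open>n\<close> because \<open>\<tau>\<^sub>0\<^sub>n\<close> stretches words by at most a
  constant factor \<open>L\<close>.\<close>

lemma image_length_growing:
  assumes "everywhere_growing A \<tau>"
  shows "\<exists>M. \<forall>m\<ge>M. \<forall>a\<in>A m. N \<le> length (img n m a)"
proof -
  obtain L where L: "L > 0" "\<And>a. a \<in> A n \<Longrightarrow> length (img 0 n a) \<le> L"
    using bounded_image_length by blast
  have "\<forall>\<^sub>F m in at_top. L * N \<le> Min ((\<lambda>a. length (img 0 m a)) ` A m)"
    using assms by (simp add: everywhere_growing_def filterlim_at_top)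
  then obtain M where M: "\<And>m. m \<ge> M \<Longrightarrow> L * N \<le> Min ((\<lambda>a. length (img 0 m a)) ` A m)"
    by (auto simp: eventually_at_top_linorder)
  have "N \<le> length (img n m a)" if "m \<ge> max M n" "a \<in> A m" for m a
  proof -
    have "L * N \<le> length (img 0 m a)"
      using M[of m] that finite_alphabet by (simp add: Min_ge_iff alphabet_nonempty)
    also have "img 0 m a = subst_word (img 0 n) (img n m a)"
      using that by (simp add: subst_word_composite_letter composite_composite)
    also have "length \<dots> \<le> L * length (img n m a)"
      using L(2) set_composite[of n m "[a]"] that by (intro length_subst_word_le) auto
    finally show ?thesis using L(1) by simp
  qed
  then show ?thesis by blast
qed

text \<open>Two points of a tower level come from \<open>x\<close> and \<open>x'\<close> with the same letter \<open>a\<close> at the origin. The images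
  under \<open>\<tau>\<^sub>p\<^sub>m\<close> agree on the block of \<open>a\<close> and, by decisiveness, on one more letter on each side; applying
  \<open>\<tau>\<^sub>n\<^sub>p\<close>, these two letters contribute agreement on at least \<open>N\<close> coordinates beyond the block.\<close>

lemma narrow_if_decisive_step:
  assumes le: "n \<le> p" "p \<le> m" and dec: "decisive_step p m"
    and N: "\<And>c. c \<in> A p \<Longrightarrow> N \<le> length (img n p c)"
  shows "narrow n m N"
  unfolding narrow_def
proof (intro ballI allI impI)
  fix a k y y' i
  assume a: "a \<in> A m" and k: "k < length (img n m a)" and y: "y \<in> tower_level n m a k" "y' \<in> tower_level n m a k"
    and i: "i \<in> {- int N..int N}"
  obtain l r where lr: "\<And>a b. \<lbrakk>a \<in> A m; b \<in> A m; [a, b] \<in> language (X m)\<rbrakk> \<Longrightarrow>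
      prefix [r a] (img p m b) \<and> suffix [l b] (img p m a)"
    using dec unfolding decisive_step_def by blast
  let ?\<sigma> = "img p m" and ?\<rho> = "img n p"
  define q where "q = length (?\<sigma> a)"
  have central: "subst_seq ?\<sigma> x j = (if j < 0 then l a else if j < int q then ?\<sigma> a ! nat j else r a)"
    if "x \<in> X m" "x 0 = a" "j \<in> {-1..int q}" for x j
  proof -
    have ne: "?\<sigma> (x i) \<noteq> []" for i using that level_shift_image_nonempty by blast
    have "[x 0, x 1] \<in> language (X m)"
      unfolding pair_in_language_iff using that(1) by blast
    moreover have "[x (-1), x 0] \<in> language (X m)"
      unfolding pair_in_language_iff
      by (rule bexI[OF _ level_shift_translate[OF that(1), of "-1"]]) simp
    ultimately have "[a, x 1] \<in> language (X m)" "[x (-1), a] \<in> language (X m)"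
      using that(2) by simp_all
    then have "prefix [r a] (?\<sigma> (x 1))" "suffix [l a] (?\<sigma> (x (-1)))"
      using lr that(1,2) level_shift_letter by metis+
    then have ends: "hd (?\<sigma> (x 1)) = r a" "last (?\<sigma> (x (-1))) = l a"
      by (auto simp: prefix_def suffix_def)
    consider "j = -1" | "j = int q" | "0 \<le> j" "j < int q"
      using \<open>j \<in> {-1..int q}\<close> by fastforce
    then show ?thesis
    proof cases
      case 1
      then show ?thesis using subst_seq_before[of ?\<sigma> x, OF ne] ends(2) by simp
    next
      case 2
      then show ?thesis
        using subst_seq_after[of ?\<sigma> x, OF ne] that(2) ends(1) by (simp add: q_def)
    next
      case 3
      then show ?thesis
        using subst_seq_block[of ?\<sigma> x "nat j" 0, OF ne] that(2) by (simp add: q_def)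
    qed
  qed
  obtain x x' where x: "x \<in> X m" "x 0 = a" "y = (\<lambda>i. subst_seq (img n m) x (i + int k))"
    and x': "x' \<in> X m" "x' 0 = a" "y' = (\<lambda>i. subst_seq (img n m) x' (i + int k))"
    using y unfolding tower_level_iff by blast
  define z where "z = subst_seq ?\<sigma> x"
  define z' where "z' = subst_seq ?\<sigma> x'"
  have zX: "z \<in> X p" "z' \<in> X p" unfolding z_def z'_def using x x' le subst_seq_level_shift by auto
  have zz: "z j = z' j" if "j \<in> {-1..int q}" for j
    using central that x x' by (simp add: z_def z'_def)
  have "factor_at z 0 q = ?\<sigma> a"
    by (rule nth_equalityI) (use central[OF x(1,2)] in \<open>auto simp: q_def z_def\<close>)
  then have bs_q: "block_start ?\<rho> z (int q) = int (length (img n m a))"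
    using le by (simp add: block_start_def subst_word_composite_letter composite_composite)
  have big: "int N \<le> int (length (?\<rho> (z j)))" for j
    using N zX level_shift_letter by simp
  have "subst_seq ?\<rho> z (i + int k) = subst_seq ?\<rho> z' (i + int k)"
  proof (rule subst_seq_cong[where p = "-1" and q = "int q + 1"])
    show "block_start ?\<rho> z (-1) \<le> i + int k"
      using block_start_Suc[of ?\<rho> z "-1"] big[of "-1"] i by simp
    show "i + int k < block_start ?\<rho> z (int q + 1)"
      using big[of "int q"] i k by (simp add: block_start_Suc bs_q)
  qed (use zX zz level_shift_image_nonempty in auto)
  then show "y i = y' i"
    using x x' le by (simp add: subst_seq_img_composite[of n p m] z_def z'_def)
qed

text \<open>The letter before the block of \<open>a\<close> is visible from the first coordinate of the block and the letter
  after it from the last one, at distance \<open>1\<close>. The maps \<open>l\<close> and \<open>r\<close> take arbitrary values at letters that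
  occur in no point.\<close>

lemma decisive_step_if_narrow:
  assumes "n \<le> m" "narrow n m 1"
  shows "decisive_step n m"
proof -
  let ?\<sigma> = "img n m"
  have inA: "set (?\<sigma> c) \<subseteq> A n" "?\<sigma> c \<noteq> []" if "c \<in> A m" for c
    using set_composite[of n m "[c]"] assms(1) that img_nonempty by auto
  define r where "r a = (SOME e. e \<in> A n \<and> (\<forall>x\<in>X m. x 0 = a \<longrightarrow> hd (?\<sigma> (x 1)) = e))" for a
  define l where "l a = (SOME e. e \<in> A n \<and> (\<forall>x\<in>X m. x 0 = a \<longrightarrow> last (?\<sigma> (x (-1))) = e))" for a
  have eq: "hd (?\<sigma> (x 1)) = hd (?\<sigma> (x' 1)) \<and> last (?\<sigma> (x (-1))) = last (?\<sigma> (x' (-1)))"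
    if x: "x \<in> X m" "x' \<in> X m" "x 0 = a" "x' 0 = a" "a \<in> A m" for x x' a
  proof -
    have ne: "?\<sigma> (x i) \<noteq> []" "?\<sigma> (x' i) \<noteq> []" for i using x level_shift_image_nonempty by auto
    have tower_level: "(\<lambda>i. subst_seq ?\<sigma> x (i + int k)) i = (\<lambda>i. subst_seq ?\<sigma> x' (i + int k)) i"
      if "k < length (?\<sigma> a)" "i \<in> {-1..1}" for k i
    proof -
      have "(\<lambda>i. subst_seq ?\<sigma> x (i + int k)) \<in> tower_level n m a k"
        "(\<lambda>i. subst_seq ?\<sigma> x' (i + int k)) \<in> tower_level n m a k"
        using x unfolding tower_level_iff by auto
      then show ?thesis
        using assms(2) that x(5) unfolding narrow_def by (metis of_nat_1)
    qed
    have pos: "0 < length (?\<sigma> a)" using inA x(5) by simp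
    \<comment> \<open>The last coordinate of the block, seen one step to the right.\<close>
    then have "subst_seq ?\<sigma> x (int (length (?\<sigma> a))) = subst_seq ?\<sigma> x' (int (length (?\<sigma> a)))"
      using tower_level[of "length (?\<sigma> a) - 1" 1] by (simp add: of_nat_diff Suc_le_eq)
    moreover have "subst_seq ?\<sigma> x (-1) = subst_seq ?\<sigma> x' (-1)"
      using tower_level[of 0 "-1"] pos by simp
    ultimately show ?thesis
      using subst_seq_before[of ?\<sigma> x, OF ne(1)] subst_seq_before[of ?\<sigma> x', OF ne(2)]
        subst_seq_after[of ?\<sigma> x, OF ne(1)] subst_seq_after[of ?\<sigma> x', OF ne(2)] x(3,4) by simp
  qed
  \<comment> \<open>Without a point through a, any letter of the alphabet serves as e.\<close>
  have ex: "\<exists>e. e \<in> A n \<and> (\<forall>x\<in>X m. x 0 = a \<longrightarrow> hd (?\<sigma> (x 1)) = e)"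
    "\<exists>e. e \<in> A n \<and> (\<forall>x\<in>X m. x 0 = a \<longrightarrow> last (?\<sigma> (x (-1))) = e)" if a: "a \<in> A m" for a
  proof -
    show "\<exists>e. e \<in> A n \<and> (\<forall>x\<in>X m. x 0 = a \<longrightarrow> hd (?\<sigma> (x 1)) = e)"
    proof (cases "\<exists>x\<in>X m. x 0 = a")
      case True
      then obtain x where x: "x \<in> X m" "x 0 = a" by blast
      have "hd (?\<sigma> (x 1)) \<in> A n"
        using inA[OF level_shift_letter[OF x(1), of 1]] by (meson hd_in_set subsetD)
      with x eq a show ?thesis by blast
    qed (use alphabet_nonempty in auto)
    show "\<exists>e. e \<in> A n \<and> (\<forall>x\<in>X m. x 0 = a \<longrightarrow> last (?\<sigma> (x (-1))) = e)"
    proof (cases "\<exists>x\<in>X m. x 0 = a")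
      case True
      then obtain x where x: "x \<in> X m" "x 0 = a" by blast
      have "last (?\<sigma> (x (-1))) \<in> A n"
        using inA[OF level_shift_letter[OF x(1), of "-1"]] by (meson last_in_set subsetD)
      with x eq a show ?thesis by blast
    qed (use alphabet_nonempty in auto)
  qed
  note r = someI_ex[OF ex(1), folded r_def] and l = someI_ex[OF ex(2), folded l_def]
  have "prefix [r a] (?\<sigma> b) \<and> suffix [l b] (?\<sigma> a)"
    if ab: "a \<in> A m" "b \<in> A m" "[a, b] \<in> language (X m)" for a b
  proof -
    obtain x where x: "x \<in> X m" "x 0 = a" "x 1 = b" using ab(3) unfolding pair_in_language_iff by blast
    have "hd (?\<sigma> b) = r a" using r[OF ab(1)] x by auto
    moreover have "last (?\<sigma> a) = l b"
      using bspec[OF conjunct2[OF l[OF ab(2)]] level_shift_translate[OF x(1), of 1]] x by simp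
    ultimately show ?thesis
      using inA(2)[OF ab(1)] inA(2)[OF ab(2)]
      by (metis append_butlast_last_id append_Cons append_Nil list.collapse prefixI suffixI)
  qed
  then show ?thesis unfolding decisive_step_def using l r by blast
qed

section \<open>Contractions\<close>

lemma composite_contraction:
  assumes "mono K" "n \<le> m"
  shows "composite (\<lambda>i. img (K i) (K (Suc i))) n m w = composite \<tau> (K n) (K m) w"
  using assms(2)
proof (induction m arbitrary: w rule: dec_induct)
  case (step m)
  then show ?case using monoD[OF assms(1), of n m] monoD[OF assms(1), of m "Suc m"]
    by (simp add: composite_Suc subst_word_composite_letter composite_composite)
qed simp

text \<open>A factor witnessed at some level is witnessed at all deeper ones, in particular at the levels that
  the contraction keeps. Here \<open>K\<close> may repeat a value, as it does when an initial identity is kept.\<close>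

lemma level_shift_contraction:
  assumes K: "mono K" "\<And>N. \<exists>i. N \<le> K i"
  shows "level_shift (\<lambda>i. A (K i)) (\<lambda>i. img (K i) (K (Suc i))) n = X (K n)"
proof -
  have "(\<exists>m>n. \<exists>a\<in>A (K m). sublist w (composite (\<lambda>i. img (K i) (K (Suc i))) n m [a])) \<longleftrightarrow>
      (\<exists>m>K n. \<exists>a\<in>A m. sublist w (img (K n) m a))" (is "?L \<longleftrightarrow> ?R") for w
  proof
    assume ?L
    then obtain m a where m: "m > n" "a \<in> A (K m)" "sublist w (img (K n) (K m) a)"
      by (auto simp: composite_contraction[OF K(1)])
    then have "K n \<le> K m" using K(1) by (simp add: monoD)
    with m factor_occurs_deeper[of "K n" "K m" "Suc (K m)" a w] show ?R
      by (metis le_SucI le_imp_less_Suc order_refl)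
  next
    assume ?R
    then obtain m a where m: "m > K n" "a \<in> A m" "sublist w (img (K n) m a)" by blast
    obtain i where i: "m \<le> K i" using K(2) by blast
    with m K(1) have "n < i" by (metis linorder_not_less monoD order.trans)
    moreover obtain b where "b \<in> A (K i)" "sublist w (img (K n) (K i) b)"
      using factor_occurs_deeper[of "K n" m "K i" a w] m i by auto
    ultimately show ?L by (intro exI[of _ i] conjI bexI[of _ b]) (simp_all add: composite_contraction[OF K(1)])
  qed
  then show ?thesis unfolding level_shift_def by simp
qed

text \<open>Both forms of a contraction are treated as one weakly increasing unbounded sequence \<open>K\<close>: in the
  first form \<open>0\<close> is put in front of \<open>k\<close>, and a repeated \<open>0\<close> encodes the identity.\<close>

lemma decisive_contractionD:
  assumes "is_contraction A \<tau> A' \<tau>'" "decisive A' \<tau>'"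
  shows "\<exists>K. mono K \<and> (\<forall>N. \<exists>i. N \<le> K i) \<and> (\<forall>i. decisive_step (K i) (K (Suc i)))"
proof -
  have "\<exists>K. mono K \<and> (\<forall>N. \<exists>i. N \<le> K i) \<and> A' = (\<lambda>i. A (K i)) \<and> \<tau>' = (\<lambda>i. img (K i) (K (Suc i)))"
  proof -
    obtain k where k: "strict_mono k"
      "A' = case_nat (A 0) (\<lambda>i. A (k i)) \<and>
          \<tau>' = case_nat (img 0 (k 0)) (\<lambda>i. img (k i) (k (Suc i)))
         \<or> k 0 = 0 \<and> A' = (\<lambda>i. A (k i)) \<and> \<tau>' = (\<lambda>i. img (k i) (k (Suc i)))"
      using assms(1) unfolding is_contraction_def by blast
    have unb: "i \<le> k i" for i using k(1) by (rule strict_mono_imp_increasing)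
    from k(2) show ?thesis
    proof
      assume eq: "A' = case_nat (A 0) (\<lambda>i. A (k i)) \<and>
          \<tau>' = case_nat (img 0 (k 0)) (\<lambda>i. img (k i) (k (Suc i)))"
      define K where "K = case_nat 0 k"
      have "mono K" unfolding mono_iff_le_Suc K_def
        using k(1) by (auto split: nat.split simp: strict_mono_less_eq)
      moreover have "N \<le> K (Suc N)" for N using unb by (simp add: K_def)
      moreover have "A' = (\<lambda>i. A (K i))" "\<tau>' = (\<lambda>i. img (K i) (K (Suc i)))"
        using eq by (auto simp: K_def fun_eq_iff split: nat.split)
      ultimately show ?thesis by blast
    qed (use unb k(1) strict_mono_mono in blast)
  qed
  then obtain K where K: "mono K" "\<And>N. \<exists>i. N \<le> K i" "A' = (\<lambda>i. A (K i))"
    "\<tau>' = (\<lambda>i. img (K i) (K (Suc i)))" by blast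
  have "decisive_step (K i) (K (Suc i))" for i
    using assms(2) unfolding decisive_def decisive_step_def K(3,4) level_shift_contraction[OF K(1,2)]
    by blast
  with K show ?thesis by blast
qed

lemma decisive_contractionI:
  assumes K: "strict_mono K" "K 0 = 0" and growing: "everywhere_growing A \<tau>"
    and dec: "\<And>i. decisive_step (K i) (K (Suc i))"
  shows "\<exists>A' \<tau>'. is_contraction A \<tau> A' \<tau>' \<and> decisive A' \<tau>'"
proof -
  let ?A = "\<lambda>i. A (K i)" and ?\<tau> = "\<lambda>i. img (K i) (K (Suc i))"
  have mono: "mono K" using K(1) by (rule strict_mono_mono)
  have le: "K i \<le> K (Suc i)" for i using mono by (simp add: monoD)
  have "is_contraction A \<tau> ?A ?\<tau>" unfolding is_contraction_def using K by blast
  moreover have "directive_sequence ?A ?\<tau>"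
  proof -
    have "substitution (A (K (Suc i))) (A (K i)) (?\<tau> i)" for i
      unfolding substitution_def
    proof (intro conjI ballI)
      fix a assume a: "a \<in> A (K (Suc i))"
      show "?\<tau> i a \<in> lists (A (K i))"
        using set_composite[OF le[of i], of "[a]"] a by (simp add: in_lists_conv_set subset_iff)
      show "?\<tau> i a \<noteq> []" using a by (rule img_nonempty)
    next
      fix b assume "b \<in> A (K i)"
      then show "\<exists>a\<in>A (K (Suc i)). b \<in> set (?\<tau> i a)" using letter_occurs_deeper[OF le] by blast
    qed
    then show ?thesis using directive by (simp add: directive_sequence_def)
  qed
  moreover have "everywhere_growing ?A ?\<tau>"
    using filterlim_compose[OF growing[unfolded everywhere_growing_def] filterlim_subseq[OF K(1)]]
    by (simp add: everywhere_growing_def composite_contraction[OF mono] K(2))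
  moreover have "level_shift ?A ?\<tau> i = X (K i)" for i
    using mono strict_mono_imp_increasing[OF K(1)] by (intro level_shift_contraction) auto
  ultimately show ?thesis
    using dec unfolding decisive_def decisive_step_def by (intro exI[of _ ?A] exI[of _ ?\<tau>]) simp
qed

lemma decisive_contraction_iff_narrowing:
  assumes growing: "everywhere_growing A \<tau>"
  shows "(\<exists>A' \<tau>'. is_contraction A \<tau> A' \<tau>' \<and> decisive A' \<tau>') \<longleftrightarrow> narrowing"
proof
  assume "\<exists>A' \<tau>'. is_contraction A \<tau> A' \<tau>' \<and> decisive A' \<tau>'"
  then obtain K where K: "mono K" "\<And>N. \<exists>i. N \<le> K i" "\<And>i. decisive_step (K i) (K (Suc i))"
    using decisive_contractionD by blast
  show narrowing
    unfolding narrowing_def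
  proof (intro allI)
    fix n N
    obtain M where M: "\<And>m a. m \<ge> M \<Longrightarrow> a \<in> A m \<Longrightarrow> N \<le> length (img n m a)"
      using image_length_growing[OF growing] by blast
    obtain i where i: "max (Suc n) M \<le> K i" using K(2) by blast
    moreover have "K i \<le> K (Suc i)" using K(1) by (simp add: monoD)
    ultimately show "\<exists>m>n. narrow n m N"
      using K(3)[of i] M by (intro exI[of _ "K (Suc i)"] conjI narrow_if_decisive_step[of n "K i"]) auto
  qed
next
  assume narrowing
  then have "\<exists>m>n. decisive_step n m" for n
    unfolding narrowing_def using decisive_step_if_narrow by (meson less_imp_le)
  then obtain h where h: "\<And>n. n < h n" "\<And>n. decisive_step n (h n)" by metis
  define K where "K i = (h ^^ i) 0" for i
  have "strict_mono K" using h(1) by (simp add: strict_mono_Suc_iff K_def)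
  then show "\<exists>A' \<tau>'. is_contraction A \<tau> A' \<tau>' \<and> decisive A' \<tau>'"
    using h(2) growing by (intro decisive_contractionI[of K]) (auto simp: K_def)
qed

section \<open>Addresses and generation of the topology\<close>

definition addresses_determine_points :: bool where
  "addresses_determine_points \<longleftrightarrow> (\<forall>u a n. address A \<tau> u a \<longrightarrow>
     (\<exists>y. (\<Inter>m\<in>{n<..}. tower_level n m (a m) (address_shift u n m)) = {y}))"

lemma addressD:
  assumes "address A \<tau> u a"
  shows "prefix (u j @ [a j]) (\<tau> j (a (Suc j)))" "a j \<in> A j" "[a j] \<in> language (X j)"
  using assms by (auto simp: address_def)

text \<open>Existence of a common point is automatic, so only uniqueness has to be checked.\<close>

lemma addresses_determine_pointsI:
  assumes "\<And>u a n y y' i. \<lbrakk>address A \<tau> u a;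
      \<And>m. n < m \<Longrightarrow> y \<in> tower_level n m (a m) (address_shift u n m);
      \<And>m. n < m \<Longrightarrow> y' \<in> tower_level n m (a m) (address_shift u n m)\<rbrakk> \<Longrightarrow> y i = y' i"
  shows addresses_determine_points
  unfolding addresses_determine_points_def
proof (intro allI impI)
  fix u a n assume ua: "address A \<tau> u a"
  define z where "z m = (SOME z. z \<in> tower_level n m (a m) (address_shift u n m))" for m
  have "z m \<in> tower_level n m (a m) (address_shift u n m)" for m
    using tower_level_nonempty_iff[of n m "a m"] addressD(3)[OF ua, of m] unfolding z_def some_in_eq by blast
  then obtain y where y: "\<forall>m>n. y \<in> tower_level n m (a m) (address_shift u n m)"
    using address_limit[of u a n z] addressD(1)[OF ua] by blast
  have "y' = y" if "\<forall>m>n. y' \<in> tower_level n m (a m) (address_shift u n m)" for y'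
    using assms[OF ua, of n y' y] y that by (intro ext) blast
  then show "\<exists>y. (\<Inter>m\<in>{n<..}. tower_level n m (a m) (address_shift u n m)) = {y}"
    using y by (intro exI[of _ y]) blast
qed

lemma narrowing_imp_addresses_determine_points:
  assumes narrowing
  shows addresses_determine_points
proof (rule addresses_determine_pointsI)
  fix u a n y y' i
  assume ua: "address A \<tau> u a"
    and y: "\<And>m. n < m \<Longrightarrow> y \<in> tower_level n m (a m) (address_shift u n m)"
      "\<And>m. n < m \<Longrightarrow> y' \<in> tower_level n m (a m) (address_shift u n m)"
  obtain m where m: "m > n" "narrow n m (nat \<bar>i\<bar>)" using assms unfolding narrowing_def by blast
  have "address_shift u n m < length (img n m (a m))"
    using address_shift_less[of m u a n] addressD(1)[OF ua] m by auto
  moreover have "i \<in> {- int (nat \<bar>i\<bar>)..int (nat \<bar>i\<bar>)}" by auto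
  ultimately show "y i = y' i"
    using m y addressD(2)[OF ua] unfolding narrow_def by blast
qed

text \<open>Koenig's lemma, applied to the tree of tower levels that contain two points differing on
  \<open>[-N, N]\<close>. Addresses of finite depth \<open>M\<close> leading to such a level exist for every \<open>M\<close>; a cluster point
  of them is an infinite address all of whose levels have the property, because a tower level inherits
  it from the smaller ones further along the address.\<close>

lemma addresses_determine_points_imp_narrowing:
  assumes addresses_determine_points
  shows narrowing
proof (rule ccontr)
  assume "\<not> narrowing"
  then obtain n N where "\<And>m. m > n \<Longrightarrow> \<not> narrow n m N" unfolding narrowing_def by blast
  define wide where "wide Y \<longleftrightarrow> (\<exists>y\<in>Y. \<exists>y'\<in>Y. \<exists>i\<in>{- int N..int N}. y i \<noteq> y' i)" for Y :: "(int \<Rightarrow> 'a) set"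
  have "\<exists>b k. b \<in> A m \<and> k < length (img n m b) \<and> wide (tower_level n m b k)" if "m > n" for m
    using \<open>\<And>m. m > n \<Longrightarrow> \<not> narrow n m N\<close>[OF that] unfolding narrow_def wide_def by blast
  then obtain b k where bk: "\<And>m. m > n \<Longrightarrow> b m \<in> A m" "\<And>m. m > n \<Longrightarrow> k m < length (img n m (b m))"
    "\<And>m. m > n \<Longrightarrow> wide (tower_level n m (b m) (k m))" by metis
  have "\<exists>u a. a M = b M \<and> address_shift u n M = k M \<and>
      (\<forall>j<M. prefix (u j @ [a j]) (\<tau> j (a (Suc j)))) \<and> (\<forall>j\<le>M. a j \<in> A j)" if "M > n" for M
    using address_exists[OF bk(1,2)[OF that]] .
  then obtain u a where ua: "\<And>M. M > n \<Longrightarrow> a M M = b M" "\<And>M. M > n \<Longrightarrow> address_shift (u M) n M = k M"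
    "\<And>M j. M > n \<Longrightarrow> j < M \<Longrightarrow> prefix (u M j @ [a M j]) (\<tau> j (a M (Suc j)))"
    "\<And>M j. M > n \<Longrightarrow> j \<le> M \<Longrightarrow> a M j \<in> A j" by metis
  have "\<exists>e. e \<in> A j" for j using alphabet_nonempty by blast
  then obtain d where d: "\<And>j. d j \<in> A j" by metis
  \<comment> \<open>Address of depth Suc n + M, continued by default values.\<close>
  define f where "f M j = (if j < Suc n + M then (a (Suc n + M) j, u (Suc n + M) j) else (d j, []))" for M j
  define F where "F j = A j \<times> (insert [] (\<Union>c\<in>A (Suc j). set (prefixes (\<tau> j c))))" for j
  have "\<exists>g. (\<forall>i. g i \<in> F i) \<and> (\<forall>J M. finite J \<longrightarrow> (\<exists>N\<ge>M. \<forall>i\<in>J. f N i = g i))"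
  proof (rule cluster_point)
    show "finite (F j)" for j using finite_alphabet by (simp add: F_def)
    fix M j
    show "f M j \<in> F j"
    proof (cases "j < Suc n + M")
      case True
      then have "prefix (u (Suc n + M) j) (\<tau> j (a (Suc n + M) (Suc j)))"
        using ua(3)[of "Suc n + M" j] by (auto dest: append_prefixD)
      with True ua(4)[of "Suc n + M" j] ua(4)[of "Suc n + M" "Suc j"] show ?thesis
        by (auto simp: f_def F_def)
    qed (use d in \<open>auto simp: f_def F_def\<close>)
  qed
  then obtain g where g: "\<And>J M. finite J \<Longrightarrow> \<exists>N\<ge>M. \<forall>i\<in>J. f N i = g i" by blast
  define a' where "a' j = fst (g j)" for j
  define u' where "u' j = snd (g j)" for j
  have near: "\<exists>M>max m n. \<forall>j\<le>m. a M j = a' j \<and> u M j = u' j" for m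
  proof -
    obtain N where N: "N \<ge> m" "\<forall>j\<in>{..m}. f N j = g j" using g[of "{..m}" m] by auto
    then have "(a (Suc n + N) j, u (Suc n + N) j) = g j" if "j \<le> m" for j
      using that by (auto simp: f_def dest!: bspec[of _ _ j])
    then have "a (Suc n + N) j = a' j \<and> u (Suc n + N) j = u' j" if "j \<le> m" for j
      using that by (simp add: a'_def u'_def flip: \<open>\<And>j. j \<le> m \<Longrightarrow> _ = g j\<close>)
    with N(1) show ?thesis by (intro exI[of _ "Suc n + N"]) auto
  qed
  have pre: "prefix (u' j @ [a' j]) (\<tau> j (a' (Suc j)))" and a'A: "a' j \<in> A j" for j
  proof -
    obtain M where M: "M > max (Suc j) n" "\<forall>i\<le>Suc j. a M i = a' i \<and> u M i = u' i" using near by blast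
    then have "a M j = a' j" "u M j = u' j" "a M (Suc j) = a' (Suc j)" by auto
    then show "prefix (u' j @ [a' j]) (\<tau> j (a' (Suc j)))" "a' j \<in> A j"
      using ua(3)[of M j] ua(4)[of M j] M(1) by auto
  qed
  have wide: "wide (tower_level n m (a' m) (address_shift u' n m))" if "n < m" for m
  proof -
    obtain M where M: "M > max m n" "\<forall>j\<le>m. a M j = a' j \<and> u M j = u' j" using near by blast
    have "address_shift (u M) n m = address_shift u' n m"
      unfolding address_shift_def by (intro sum.cong) (use M in auto)
    then have "tower_level n M (b M) (k M) \<subseteq> tower_level n m (a' m) (address_shift u' n m)"
      using address_tower_nested[of M "u M" "a M" n m] ua(1-3)[of M] M that by simp
    moreover have "wide (tower_level n M (b M) (k M))" using bk(3) M by simp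
    ultimately show ?thesis unfolding wide_def by blast
  qed
  \<comment> \<open>For j at most n, the property comes from a deeper level, through the towers over level j.\<close>
  have "[a' j] \<in> language (X j)" for j
  proof -
    define m where "m = max (Suc n) j"
    have "tower_level n m (a' m) (address_shift u' n m) \<noteq> {}"
      using wide[of m] unfolding wide_def by (auto simp: m_def less_max_iff_disj)
    then have "tower_level j m (a' m) (address_shift u' j m) \<noteq> {}" by (simp only: tower_level_nonempty_iff)
    then have "tower_level j j (a' j) (address_shift u' j j) \<noteq> {}"
      using address_tower_nested[of m u' a' j j, OF pre] by (auto simp: m_def)
    then show ?thesis by (simp only: tower_level_nonempty_iff)
  qed
  moreover have "u' j \<in> lists (A j)" for j
    using pre[of j] letter_image(2)[OF a'A[of "Suc j"]] by (auto simp: prefix_def)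
  ultimately have "address A \<tau> u' a'" unfolding address_def using pre a'A by blast
  from assms[unfolded addresses_determine_points_def, rule_format, OF this, of n]
  obtain y where y: "(\<Inter>m\<in>{n<..}. tower_level n m (a' m) (address_shift u' n m)) = {y}" ..
  have "\<exists>z. z \<in> tower_level n m (a' m) (address_shift u' n m) \<and> (\<exists>i\<in>{- int N..int N}. z i \<noteq> y i)"
    if "n < m" for m
  proof -
    from wide[OF that] obtain z z' i where "z \<in> tower_level n m (a' m) (address_shift u' n m)"
      "z' \<in> tower_level n m (a' m) (address_shift u' n m)" "i \<in> {- int N..int N}" "z i \<noteq> z' i"
      unfolding wide_def by blast
    then show ?thesis by (cases "z i = y i") (metis, blast)
  qed
  then obtain z where z: "\<And>m. n < m \<Longrightarrow> z m \<in> tower_level n m (a' m) (address_shift u' n m)"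
    "\<And>m. n < m \<Longrightarrow> \<exists>i\<in>{- int N..int N}. z m i \<noteq> y i" by metis
  \<comment> \<open>Points differing from y on the window cannot accumulate at y, but y is the only candidate.\<close>
  obtain y' where y': "\<forall>m>n. y' \<in> tower_level n m (a' m) (address_shift u' n m)"
    "\<forall>M. \<exists>m>n. \<forall>i\<in>{- int M..int M}. z m i = y' i"
    using address_limit[of u' a' n z, OF pre z(1)] by blast
  then have "y' = y" using y by blast
  with y'(2) z(2) show False by metis
qed

lemma topspace_level_topology: "topspace (level_topology A \<tau> n) = X n"
  by (auto simp: level_topology_def level_shift_letter)

lemma tower_cover_eq:
  "tower_cover A \<tau> n m = {tower_level n m a k | a k. a \<in> A m \<and> k < length (img n m a)}"
  by (simp add: tower_cover_def tower_level_def)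

lemma tower_cover_Union:
  assumes "n < m"
  shows "\<Union> (tower_cover A \<tau> n m) = X n"
proof
  show "\<Union> (tower_cover A \<tau> n m) \<subseteq> X n"
    using tower_level_subset_level_shift[of n m] assms unfolding tower_cover_eq by (auto)
  show "X n \<subseteq> \<Union> (tower_cover A \<tau> n m)"
    using point_in_tower_level[OF assms] unfolding tower_cover_eq by blast
qed

lemma openin_level_topology_window:
  assumes "openin (level_topology A \<tau> n) W" "x \<in> W"
  shows "\<exists>N. \<forall>y\<in>X n. (\<forall>i\<in>{- int N..int N}. y i = x i) \<longrightarrow> y \<in> W"
proof -
  obtain S where S: "openin (product_topology (\<lambda>_. discrete_topology (A n)) UNIV) S" "W = S \<inter> X n"
    using assms(1) unfolding level_topology_def openin_subtopology by blast
  then obtain U where U: "finite {i. U i \<noteq> A n}" "x \<in> Pi\<^sub>E UNIV U" "Pi\<^sub>E UNIV U \<subseteq> S"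
    using assms(2) unfolding openin_product_topology_alt by fastforce
  obtain N where N: "\<And>i. U i \<noteq> A n \<Longrightarrow> nat \<bar>i\<bar> \<le> N"
    using finite_nat_set_iff_bounded_le[of "(\<lambda>i. nat \<bar>i\<bar>) ` {i. U i \<noteq> A n}"] U(1) by auto
  have "y \<in> W" if y: "y \<in> X n" "\<forall>i\<in>{- int N..int N}. y i = x i" for y
  proof -
    have "y i \<in> U i" for i
    proof (cases "U i = A n")
      case False
      then have "y i = x i" using N[OF False] by (intro bspec[OF y(2)]) auto
      then show ?thesis using U(2) by auto
    qed (use y level_shift_letter in auto)
    then show ?thesis using U(3) S(2) y(1) by auto
  qed
  then show ?thesis by blast
qed

lemma openin_level_topology_coordinate: "openin (level_topology A \<tau> n) {x \<in> X n. x i = c}"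
proof -
  have "openin (product_topology (\<lambda>_. discrete_topology (A n)) UNIV)
      (\<Pi>\<^sub>E j\<in>UNIV. if j = i then {c} \<inter> A n else A n)"
    unfolding openin_PiE_gen by (auto intro: finite_subset[of _ "{i}"] split: if_splits)
  moreover have "{x \<in> X n. x i = c} = (\<Pi>\<^sub>E j\<in>UNIV. if j = i then {c} \<inter> A n else A n) \<inter> X n"
    by (auto simp: PiE_iff level_shift_letter split: if_splits)
  ultimately show ?thesis unfolding level_topology_def openin_subtopology by blast
qed

lemma narrowing_imp_generates_topology:
  assumes narrowing
  shows "generates_topology (level_topology A \<tau> n) n (tower_cover A \<tau> n)"
  unfolding generates_topology_def
proof (intro conjI allI impI ballI)
  show "\<Union> (tower_cover A \<tau> n m) = topspace (level_topology A \<tau> n)" if "n < m" for m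
    using that by (simp add: tower_cover_Union topspace_level_topology)
  fix x U
  assume "\<exists>W. openin (level_topology A \<tau> n) W \<and> x \<in> W \<and> W \<subseteq> U"
  then obtain W where W: "openin (level_topology A \<tau> n) W" "x \<in> W" "W \<subseteq> U" by blast
  obtain N where N: "\<forall>y\<in>X n. (\<forall>i\<in>{- int N..int N}. y i = x i) \<longrightarrow> y \<in> W"
    using openin_level_topology_window[OF W(1,2)] ..
  obtain m where m: "m > n" "narrow n m N" using assms unfolding narrowing_def by blast
  have "V \<subseteq> U" if V: "V \<in> tower_cover A \<tau> n m" "x \<in> V" for V
  proof
    fix y assume "y \<in> V"
    have "y \<in> X n" using tower_cover_Union[OF m(1)] V(1) \<open>y \<in> V\<close> by blast
    moreover have "\<forall>i\<in>{- int N..int N}. y i = x i"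
      using m(2) V \<open>y \<in> V\<close> unfolding narrow_def tower_cover_eq by blast
    ultimately show "y \<in> U" using N W(3) by auto
  qed
  with m(1) show "\<exists>m>n. \<forall>V\<in>tower_cover A \<tau> n m. x \<in> V \<longrightarrow> V \<subseteq> U" by blast
qed

text \<open>The points agreeing with \<open>y\<close> at coordinate \<open>i\<close> form a neighbourhood of \<open>y\<close>; it contains some set along
  the address, hence \<open>y'\<close>.\<close>

lemma generates_topology_imp_addresses_determine_points:
  assumes "\<And>n. generates_topology (level_topology A \<tau> n) n (tower_cover A \<tau> n)"
  shows addresses_determine_points
proof (rule addresses_determine_pointsI)
  fix u a n y y' i
  assume ua: "address A \<tau> u a"
    and y: "\<And>m. n < m \<Longrightarrow> y \<in> tower_level n m (a m) (address_shift u n m)"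
      "\<And>m. n < m \<Longrightarrow> y' \<in> tower_level n m (a m) (address_shift u n m)"
  let ?W = "{x \<in> X n. x i = y i}"
  have "y \<in> X n" using y(1)[of "Suc n"] tower_level_subset_level_shift[of n "Suc n"] by auto
  then have "\<exists>m>n. \<forall>V\<in>tower_cover A \<tau> n m. y \<in> V \<longrightarrow> V \<subseteq> ?W"
    using assms[of n] openin_level_topology_coordinate[of n i "y i"]
    unfolding generates_topology_def topspace_level_topology by blast
  then obtain m where m: "m > n" "\<And>V. V \<in> tower_cover A \<tau> n m \<Longrightarrow> y \<in> V \<Longrightarrow> V \<subseteq> ?W" by blast
  have "address_shift u n m < length (img n m (a m))"
    using address_shift_less[of m u a n] addressD(1)[OF ua] m by auto
  then have "tower_level n m (a m) (address_shift u n m) \<in> tower_cover A \<tau> n m"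
    using addressD(2)[OF ua] unfolding tower_cover_eq by blast
  from m(2)[OF this y(1)[OF m(1)]] y(2)[OF m(1)] show "y i = y' i" by auto
qed

end

theorem proposition3p18:
  fixes A :: "nat \<Rightarrow> 'a set" and \<tau> :: "nat \<Rightarrow> 'a \<Rightarrow> 'a list"
  assumes "directive_sequence A \<tau>" and "everywhere_growing A \<tau>"
  shows "((\<exists>A' \<tau>'. is_contraction A \<tau> A' \<tau>' \<and> decisive A' \<tau>') \<longleftrightarrow>
          (\<forall>u a n. address A \<tau> u a \<longrightarrow>
             (\<exists>y. (\<Inter>m\<in>{n<..}. (shift ^^ (\<Sum>j = n..<m. length (composite \<tau> n j (u j)))) `
                     base A \<tau> n m (a m)) = {y})))
       \<and> ((\<forall>u a n. address A \<tau> u a \<longrightarrow>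
             (\<exists>y. (\<Inter>m\<in>{n<..}. (shift ^^ (\<Sum>j = n..<m. length (composite \<tau> n j (u j)))) `
                     base A \<tau> n m (a m)) = {y})) \<longleftrightarrow>
          (\<forall>n. generates_topology (level_topology A \<tau> n) n (tower_cover A \<tau> n)))"
proof -
  interpret directive A \<tau> by standard (rule assms(1))
  have "addresses_determine_points \<longleftrightarrow> narrowing"
    using narrowing_imp_addresses_determine_points addresses_determine_points_imp_narrowing by blast
  moreover have "(\<forall>n. generates_topology (level_topology A \<tau> n) n (tower_cover A \<tau> n)) \<longleftrightarrow> narrowing"
    using narrowing_imp_generates_topology generates_topology_imp_addresses_determine_points
      addresses_determine_points_imp_narrowing by blast
  ultimately show ?thesis
    using decisive_contraction_iff_narrowing[OF assms(2)]
    unfolding addresses_determine_points_def address_shift_def tower_level_def by simp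
qed

end
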